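(* Given a minimum transmit power $\delta>0$, there is an algorithm (Opt-JSPA) that computes an optimal solution of $\mathcal P'_{MC}$ restricted to the discrete set $\mathcal F'$, i.e. a maximizer of $\sum_{n=1}^N F^n(\bar P^n)$ over $\bar{\boldsymbol P}\in\mathcal F'$. Its computational complexity is $O\left(NMK^2+JNMK+J^2N\right)$, where $J=\lfloor P_{max}/\delta\rfloor$ (which is pseudo-polynomial in $J$).
   Context: Setting. $K$ users, $N$ subcarriers, $M\ge1$; for each subcarrier $n$: bandwidth $W_n>0$, normalized noise powers $\tilde\eta^n_k>0$, and a permutation $\pi_n$ of $\{1,\dots,K\}$ with $\tilde\eta^n_{\pi_n(1)}\ge\dots\ge\tilde\eta^n_{\pi_n(K)}$; weights $w_1,\dots,w_K>0$; total power budget $P_{max}$ and per-subcarrier limits $P^n_{max}$. Define $$f^n_i(x)=\begin{cases}W_n w_{\pi_n(1)}\log_2(x+\tilde\eta^n_{\pi_n(1)}) & i=1,\\ W_n\left[w_{\pi_n(i)}\log_2(x+\tilde\eta^n_{\pi_n(i)})-w_{\pi_n(i-1)}\log_2(x+\tilde\eta^n_{\pi_n(i-1)})\right] & i>1,\end{cases}$$ and $A^n=W_n w_{\pi_n(K)}\log_2(1/\tilde\eta^n_{\pi_n(K)})$. Single-carrier optimal value. $F^n(\bar P^n)$ is the maximum of $\sum_{i=1}^K f^n_i(x^n_i)+A^n$ over $\bar P^n\ge x^n_1\ge\dots\ge x^n_K\ge0$ with $|\{i:x^n_i>x^n_{i+1}\}|\le M$, where $x^n_{K+1}=0$. Multi-carrier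 problem $\mathcal P'_{MC}$: maximize $\sum_{n=1}^N F^n(\bar P^n)$ over power budget vectors $\bar{\boldsymbol P}=(\bar P^1,\dots,\bar P^N)$ with $\sum_n\bar P^n\le P_{max}$ and $0\le\bar P^n\le P^n_{max}$ for all $n$. The discrete feasible set is $$\mathcal F'=\Big\{\bar{\boldsymbol P}:\sum_{n=1}^N\bar P^n\le P_{max},\ 0\le\bar P^n\le P^n_{max},\ \bar P^n\in\{l\delta:l=0,1,\dots,J\}\ \forall n\Big\}.$$ Complexity is the worst-case number of basic operations (real arithmetic, logarithm evaluations, comparisons), each counted with unit cost. The input consists of the $w_k$, $W_n$, $\tilde\eta^n_k$, $M$, $P_{max}$, $P^n_{max}$ and $\delta$; the functions $F^n$ are not given as oracles and must be computed by the algorithm. *)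

theory Defs
  imports "HOL-Analysis.Analysis" "HOL-Combinatorics.Permutations"
begin

section \<open>The power allocation problem\<close>

text \<open>Users and subcarriers are numbered from 1. Only the values at users in \<open>{1..K}\<close> and
  subcarriers in \<open>{1..N}\<close> are relevant.\<close>

record jspa =
  num_users :: nat                          \<comment> \<open>\<open>K\<close>\<close>
  num_subs :: nat                           \<comment> \<open>\<open>N\<close>\<close>
  max_mux :: nat                            \<comment> \<open>\<open>M\<close>\<close>
  bandwidth :: "nat \<Rightarrow> real"                \<comment> \<open>\<open>W\<^sub>n\<close>\<close>
  noise :: "nat \<Rightarrow> nat \<Rightarrow> real"             \<comment> \<open>first the subcarrier, then the user\<close>
  weight :: "nat \<Rightarrow> real"
  power_budget :: real                      \<comment> \<open>\<open>P\<^sub>m\<^sub>a\<^sub>x\<close>\<close>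
  power_limit :: "nat \<Rightarrow> real"              \<comment> \<open>per-subcarrier limit\<close>

definition valid_jspa :: "jspa \<Rightarrow> bool" where
  "valid_jspa I \<longleftrightarrow>
     1 \<le> num_users I \<and> 1 \<le> num_subs I \<and> 1 \<le> max_mux I \<and>
     (\<forall>n\<in>{1..num_subs I}. 0 < bandwidth I n) \<and>
     (\<forall>n\<in>{1..num_subs I}. \<forall>k\<in>{1..num_users I}. 0 < noise I n k) \<and>
     (\<forall>k\<in>{1..num_users I}. 0 < weight I k) \<and>
     0 \<le> power_budget I \<and>
     (\<forall>n\<in>{1..num_subs I}. 0 \<le> power_limit I n)"

definition decoding_orders :: "jspa \<Rightarrow> (nat \<Rightarrow> nat \<Rightarrow> nat) \<Rightarrow> bool" where
  "decoding_orders I \<pi> \<longleftrightarrow>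
     (\<forall>n\<in>{1..num_subs I}.
        \<pi> n permutes {1..num_users I} \<and>
        (\<forall>i\<in>{1..num_users I}. \<forall>j\<in>{1..num_users I}.
           i \<le> j \<longrightarrow> noise I n (\<pi> n j) \<le> noise I n (\<pi> n i)))"

definition rate_term :: "jspa \<Rightarrow> (nat \<Rightarrow> nat \<Rightarrow> nat) \<Rightarrow> nat \<Rightarrow> nat \<Rightarrow> real \<Rightarrow> real" where
  "rate_term I \<pi> n i x =
     (if i = 1
      then bandwidth I n * weight I (\<pi> n 1) * log 2 (x + noise I n (\<pi> n 1))
      else bandwidth I n *
             (weight I (\<pi> n i) * log 2 (x + noise I n (\<pi> n i))
              - weight I (\<pi> n (i - 1)) * log 2 (x + noise I n (\<pi> n (i - 1)))))"

definition rate_offset :: "jspa \<Rightarrow> (nat \<Rightarrow> nat \<Rightarrow> nat) \<Rightarrow> nat \<Rightarrow> real" where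
  "rate_offset I \<pi> n =
     bandwidth I n * weight I (\<pi> n (num_users I)) * log 2 (1 / noise I n (\<pi> n (num_users I)))"

definition sc_feasible :: "jspa \<Rightarrow> real \<Rightarrow> (nat \<Rightarrow> real) set" where
  "sc_feasible I p =
     {x. x 1 \<le> p \<and> (\<forall>i\<in>{1..<num_users I}. x (i + 1) \<le> x i) \<and> 0 \<le> x (num_users I) \<and>
         x (num_users I + 1) = 0 \<and>
         card {i \<in> {1..num_users I}. x i > x (i + 1)} \<le> max_mux I}"

definition sc_value :: "jspa \<Rightarrow> (nat \<Rightarrow> nat \<Rightarrow> nat) \<Rightarrow> nat \<Rightarrow> (nat \<Rightarrow> real) \<Rightarrow> real" where
  "sc_value I \<pi> n x = (\<Sum>i=1..num_users I. rate_term I \<pi> n i (x i)) + rate_offset I \<pi> n"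

text \<open>The maximum exists for every \<open>p \<ge> 0\<close>; see \<open>sc_opt_attained\<close> below.\<close>

definition sc_opt :: "jspa \<Rightarrow> (nat \<Rightarrow> nat \<Rightarrow> nat) \<Rightarrow> nat \<Rightarrow> real \<Rightarrow> real" where
  "sc_opt I \<pi> n p = (GREATEST v. v \<in> sc_value I \<pi> n ` sc_feasible I p)"

definition mc_feasible :: "jspa \<Rightarrow> (nat \<Rightarrow> real) set" where
  "mc_feasible I =
     {P. (\<Sum>n=1..num_subs I. P n) \<le> power_budget I \<and>
         (\<forall>n\<in>{1..num_subs I}. 0 \<le> P n \<and> P n \<le> power_limit I n)}"

definition mc_objective :: "jspa \<Rightarrow> (nat \<Rightarrow> nat \<Rightarrow> nat) \<Rightarrow> (nat \<Rightarrow> real) \<Rightarrow> real" where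
  "mc_objective I \<pi> P = (\<Sum>n=1..num_subs I. sc_opt I \<pi> n (P n))"

definition num_levels :: "jspa \<Rightarrow> real \<Rightarrow> nat" where
  "num_levels I \<delta> = nat \<lfloor>power_budget I / \<delta>\<rfloor>"

definition mc_feasible_discrete :: "jspa \<Rightarrow> real \<Rightarrow> (nat \<Rightarrow> real) set" where
  "mc_feasible_discrete I \<delta> =
     {P \<in> mc_feasible I.
        \<forall>n\<in>{1..num_subs I}. P n \<in> {real l * \<delta> | l. l \<in> {0..num_levels I \<delta>}}}"

lemma sc_feasible_cases:
  assumes K: "1 \<le> num_users I" and x: "x \<in> sc_feasible I p" and i: "i \<in> {1..num_users I}"
  shows "0 \<le> x i" "x i \<le> p"
proof -
  let ?K = "num_users I"
  have mono: "x (i + 1) \<le> x i" if "1 \<le> i" "i < ?K" for i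
    using x that by (auto simp: sc_feasible_def)
  have dec: "x b \<le> x a" if "1 \<le> a" "a \<le> b" "b \<le> ?K" for a b
    using that(2,1,3)
  proof (induction rule: dec_induct)
    case (step m)
    then show ?case using mono[of m] by force
  qed simp
  show "0 \<le> x i" using dec[of i ?K] i x by (auto simp: sc_feasible_def)
  show "x i \<le> p" using dec[of 1 i] i x by (auto simp: sc_feasible_def)
qed

lemma sc_opt_attained:
  assumes I: "valid_jspa I" and \<pi>: "decoding_orders I \<pi>" and n: "n \<in> {1..num_subs I}"
    and p: "0 \<le> p"
  shows "\<exists>x\<in>sc_feasible I p. sc_opt I \<pi> n p = sc_value I \<pi> n x \<and>
           (\<forall>y\<in>sc_feasible I p. sc_value I \<pi> n y \<le> sc_value I \<pi> n x)"
proof -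
  let ?K = "num_users I"
  have K: "1 \<le> ?K" using I by (simp add: valid_jspa_def)
  define B where "B = (\<lambda>i. if i \<in> {1..?K} then {0..p} else {0::real})"
  define C where "C = (\<Pi>\<^sub>E i\<in>UNIV. B i)"
  define \<T> where "\<T> = {T. T \<subseteq> {1..?K} \<and> card T \<le> max_mux I}"
  define E where "E = (\<Union>T\<in>\<T>. {x. (\<forall>i\<in>{1..<?K}. x (i + 1) \<le> x i) \<and>
      (\<forall>i\<in>{1..?K} - T. x i \<le> x (i + 1))} :: (nat \<Rightarrow> real) set)"
  have "compactin (product_topology (\<lambda>i. euclidean) UNIV) C"
    unfolding C_def compactin_PiE by (auto simp: B_def)
  then have "compact C"
    by (simp add: euclidean_product_topology)
  moreover have "closed E"
    unfolding E_def
  proof (rule closed_UN)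
    show "finite \<T>" unfolding \<T>_def by simp
    show "\<forall>T\<in>\<T>. closed {x. (\<forall>i\<in>{1..<?K}. x (i + 1) \<le> x i) \<and>
      (\<forall>i\<in>{1..?K} - T. x i \<le> (x (i + 1) :: real))}"
      unfolding Ball_def
      by (intro allI impI closed_Collect_conj closed_Collect_all closed_Collect_imp
          open_Collect_const closed_Collect_le continuous_on_product_coordinates)
  qed
  ultimately have comp: "compact (C \<inter> E)" by (rule compact_Int_closed)
  have sub: "x \<in> sc_feasible I p" if "x \<in> C \<inter> E" for x
  proof -
    from that obtain T where T: "T \<in> \<T>" "\<forall>i\<in>{1..<?K}. x (i + 1) \<le> x i"
      "\<forall>i\<in>{1..?K} - T. x i \<le> x (i + 1)" by (auto simp: E_def)
    have xB: "x i \<in> B i" for i using that by (auto simp: C_def)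
    have "{i \<in> {1..?K}. x i > x (i + 1)} \<subseteq> T" using T(3) by force
    moreover have "finite T" using T(1) finite_subset by (auto simp: \<T>_def)
    ultimately have "card {i \<in> {1..?K}. x i > x (i + 1)} \<le> card T" by (intro card_mono)
    also have "\<dots> \<le> max_mux I" using T(1) by (simp add: \<T>_def)
    finally have "card {i \<in> {1..?K}. x i > x (i + 1)} \<le> max_mux I" .
    then show ?thesis
      using T(2) xB[of 1] xB[of ?K] xB[of "?K + 1"] K by (auto simp: sc_feasible_def B_def)
  qed
  have sup: "\<exists>y\<in>C \<inter> E. sc_value I \<pi> n x = sc_value I \<pi> n y" if x: "x \<in> sc_feasible I p" for x
  proof
    define y where "y = (\<lambda>i. if i \<in> {1..?K} then x i else 0)"
    have yx: "y i = x i" if "i \<in> {1..?K + 1}" for i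
      using that x by (cases "i = ?K + 1") (auto simp: y_def sc_feasible_def)
    show "sc_value I \<pi> n x = sc_value I \<pi> n y" by (simp add: sc_value_def y_def)
    have "y \<in> C" using sc_feasible_cases[OF K x] by (auto simp: C_def B_def y_def)
    moreover have "y \<in> E"
    proof -
      have "{i \<in> {1..?K}. x i > x (i + 1)} \<in> \<T>" using x by (auto simp: \<T>_def sc_feasible_def)
      moreover have "\<forall>i\<in>{1..<?K}. y (i + 1) \<le> y i"
        using x by (auto simp: y_def sc_feasible_def)
      moreover have "\<forall>i\<in>{1..?K} - {i \<in> {1..?K}. x i > x (i + 1)}. y i \<le> y (i + 1)"
        using yx by auto
      ultimately show ?thesis unfolding E_def by blast
    qed
    ultimately show "y \<in> C \<inter> E" by simp
  qed
  have ne: "C \<inter> E \<noteq> {}"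
  proof -
    have "(\<lambda>_. 0) \<in> sc_feasible I p" using p by (simp add: sc_feasible_def)
    from sup[OF this] show ?thesis by auto
  qed
  have pos: "0 < noise I n (\<pi> n i)" if "i \<in> {1..?K}" for i
  proof -
    have "\<pi> n permutes {1..?K}" using \<pi> n by (simp add: decoding_orders_def)
    then have "\<pi> n i \<in> {1..?K}" using that by (simp only: permutes_in_image)
    then show ?thesis using I n by (simp add: valid_jspa_def)
  qed
  have nz: "x i + noise I n (\<pi> n j) > 0" if "x \<in> C \<inter> E" "i \<in> {1..?K}" "j \<in> {1..?K}" for x i j
    using sc_feasible_cases(1)[OF K sub[OF that(1)] that(2)] pos[OF that(3)] by linarith
  have cont_log: "continuous_on (C \<inter> E) (\<lambda>x. log 2 (x i + noise I n (\<pi> n j)))"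
    if "i \<in> {1..?K}" "j \<in> {1..?K}" for i j
  proof -
    have c: "continuous_on (C \<inter> E) (\<lambda>x. x i + noise I n (\<pi> n j))"
      by (intro continuous_on_add continuous_on_const
          continuous_on_subset[OF continuous_on_product_coordinates]) simp
    show ?thesis
      unfolding log_def using nz[OF _ that]
      by (intro continuous_on_divide continuous_on_ln c continuous_on_const)
        (auto dest: less_imp_neq[THEN not_sym])
  qed
  have "continuous_on (C \<inter> E) (\<lambda>x. rate_term I \<pi> n i (x i))" if "i \<in> {1..?K}" for i
  proof (cases "i = 1")
    case True
    then show ?thesis using K
      by (auto simp: rate_term_def intro!: continuous_on_mult_left cont_log)
  next
    case False
    then show ?thesis using that
      by (auto simp: rate_term_def intro!: continuous_on_mult_left continuous_on_diff cont_log)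
  qed
  then have "continuous_on (C \<inter> E) (sc_value I \<pi> n)"
    unfolding sc_value_def
    by (intro continuous_on_add continuous_on_sum continuous_on_const)
  from continuous_attains_sup[OF comp ne this] obtain x where x: "x \<in> C \<inter> E"
    "\<And>y. y \<in> C \<inter> E \<Longrightarrow> sc_value I \<pi> n y \<le> sc_value I \<pi> n x" by blast
  have max: "sc_value I \<pi> n y \<le> sc_value I \<pi> n x" if "y \<in> sc_feasible I p" for y
    using sup[OF that] x(2) by metis
  have "sc_opt I \<pi> n p = sc_value I \<pi> n x"
    unfolding sc_opt_def
    by (rule Greatest_equality) (use sub[OF x(1)] max in auto)
  with sub[OF x(1)] max show ?thesis by blast
qed

section \<open>A unit-cost real random access machine\<close>

text \<open>Memory consists of named unbounded arrays, one family holding natural numbers (counters and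
  array indices) and one holding exact real numbers. A program is a finite piece of syntax and is
  thus independent of the problem size. There is no rounding and no conversion between the two
  families.\<close>

record store =
  ints :: "string \<Rightarrow> nat \<Rightarrow> nat"
  reals :: "string \<Rightarrow> nat \<Rightarrow> real"

datatype iexp =
    IConst nat
  | IGet string iexp
  | IAdd iexp iexp
  | ISub iexp iexp
  | IMul iexp iexp

datatype rexp =
    RConst rat
  | RGet string iexp
  | RAdd rexp rexp
  | RSub rexp rexp
  | RMul rexp rexp
  | RDiv rexp rexp
  | RLog2 rexp

datatype test =
    ILess iexp iexp
  | ILeq iexp iexp
  | RLess rexp rexp
  | RLeq rexp rexp

datatype com =
    Skip
  | ISet string iexp iexp
  | RSet string iexp rexp
  | Seq com com
  | If test com com
  | While test com

primrec ival :: "iexp \<Rightarrow> store \<Rightarrow> nat" where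
  "ival (IConst c) s = c"
| "ival (IGet a e) s = ints s a (ival e s)"
| "ival (IAdd d e) s = ival d s + ival e s"
| "ival (ISub d e) s = ival d s - ival e s"
| "ival (IMul d e) s = ival d s * ival e s"

text \<open>Division and logarithm are total as in the library. This adds no computational power, since
  the exceptional arguments can be recognised by comparisons with 0.\<close>

primrec rval :: "rexp \<Rightarrow> store \<Rightarrow> real" where
  "rval (RConst c) s = of_rat c"
| "rval (RGet a e) s = reals s a (ival e s)"
| "rval (RAdd d e) s = rval d s + rval e s"
| "rval (RSub d e) s = rval d s - rval e s"
| "rval (RMul d e) s = rval d s * rval e s"
| "rval (RDiv d e) s = rval d s / rval e s"
| "rval (RLog2 e) s = log 2 (rval e s)"

primrec tval :: "test \<Rightarrow> store \<Rightarrow> bool" where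
  "tval (ILess d e) s \<longleftrightarrow> ival d s < ival e s"
| "tval (ILeq d e) s \<longleftrightarrow> ival d s \<le> ival e s"
| "tval (RLess d e) s \<longleftrightarrow> rval d s < rval e s"
| "tval (RLeq d e) s \<longleftrightarrow> rval d s \<le> rval e s"

text \<open>Every arithmetic operation, logarithm, comparison, constant and memory access costs 1. Index
  arithmetic and memory accesses are charged as well, so that the cost bounds the number of
  operations on real numbers. For a fixed program it exceeds the number of comparisons only by a
  constant factor and a constant summand, as every pass through a loop evaluates a test.\<close>

primrec icost :: "iexp \<Rightarrow> nat" where
  "icost (IConst c) = 1"
| "icost (IGet a e) = 1 + icost e"
| "icost (IAdd d e) = 1 + icost d + icost e"
| "icost (ISub d e) = 1 + icost d + icost e"
| "icost (IMul d e) = 1 + icost d + icost e"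

primrec rcost :: "rexp \<Rightarrow> nat" where
  "rcost (RConst c) = 1"
| "rcost (RGet a e) = 1 + icost e"
| "rcost (RAdd d e) = 1 + rcost d + rcost e"
| "rcost (RSub d e) = 1 + rcost d + rcost e"
| "rcost (RMul d e) = 1 + rcost d + rcost e"
| "rcost (RDiv d e) = 1 + rcost d + rcost e"
| "rcost (RLog2 e) = 1 + rcost e"

primrec tcost :: "test \<Rightarrow> nat" where
  "tcost (ILess d e) = 1 + icost d + icost e"
| "tcost (ILeq d e) = 1 + icost d + icost e"
| "tcost (RLess d e) = 1 + rcost d + rcost e"
| "tcost (RLeq d e) = 1 + rcost d + rcost e"

definition iupd :: "string \<Rightarrow> nat \<Rightarrow> nat \<Rightarrow> store \<Rightarrow> store" where
  "iupd a j v s = s\<lparr>ints := (ints s)(a := (ints s a)(j := v))\<rparr>"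

definition rupd :: "string \<Rightarrow> nat \<Rightarrow> real \<Rightarrow> store \<Rightarrow> store" where
  "rupd a j v s = s\<lparr>reals := (reals s)(a := (reals s a)(j := v))\<rparr>"

text \<open>\<open>exec c s t s'\<close>: started in \<open>s\<close>, the program \<open>c\<close> terminates in \<open>s'\<close> at total cost \<open>t\<close>.\<close>

inductive exec :: "com \<Rightarrow> store \<Rightarrow> nat \<Rightarrow> store \<Rightarrow> bool" where
  Skip: "exec Skip s 1 s"
| ISet: "exec (ISet a d e) s (1 + icost d + icost e) (iupd a (ival d s) (ival e s) s)"
| RSet: "exec (RSet a d e) s (1 + icost d + rcost e) (rupd a (ival d s) (rval e s) s)"
| Seq: "exec c s t s' \<Longrightarrow> exec c' s' t' s'' \<Longrightarrow> exec (Seq c c') s (t + t') s''"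
| IfTrue: "tval b s \<Longrightarrow> exec c s t s' \<Longrightarrow> exec (If b c c') s (tcost b + t) s'"
| IfFalse: "\<not> tval b s \<Longrightarrow> exec c' s t s' \<Longrightarrow> exec (If b c c') s (tcost b + t) s'"
| WhileTrue: "tval b s \<Longrightarrow> exec c s t s' \<Longrightarrow> exec (While b c) s' t' s'' \<Longrightarrow>
    exec (While b c) s (tcost b + t + t') s''"
| WhileFalse: "\<not> tval b s \<Longrightarrow> exec (While b c) s (tcost b) s"

inductive_cases exec_SkipE: "exec Skip s t s'"
inductive_cases exec_ISetE: "exec (ISet a d e) s t s'"
inductive_cases exec_RSetE: "exec (RSet a d e) s t s'"
inductive_cases exec_SeqE: "exec (Seq c c') s t s'"
inductive_cases exec_IfE: "exec (If b c c') s t s'"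
inductive_cases exec_WhileE: "exec (While b c) s t s'"

theorem exec_deterministic:
  "exec c s t s' \<Longrightarrow> exec c s u s'' \<Longrightarrow> t = u \<and> s' = s''"
proof (induction arbitrary: u s'' rule: exec.induct)
  case Skip
  then show ?case by (auto elim: exec_SkipE)
next
  case ISet
  then show ?case by (auto elim: exec_ISetE)
next
  case RSet
  then show ?case by (auto elim: exec_RSetE)
next
  case Seq
  from Seq.prems show ?case by (rule exec_SeqE) (use Seq.IH in blast)
next
  case IfTrue
  from IfTrue.prems show ?case by (rule exec_IfE) (use IfTrue in blast)+
next
  case IfFalse
  from IfFalse.prems show ?case by (rule exec_IfE) (use IfFalse in blast)+
next
  case WhileTrue
  from WhileTrue.prems show ?case by (rule exec_WhileE) (use WhileTrue.hyps WhileTrue.IH in blast)+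
next
  case WhileFalse
  from WhileFalse.prems show ?case by (rule exec_WhileE) (use WhileFalse.hyps in auto)
qed

text \<open>Input convention. The decoding orders, \<open>num_levels\<close> and the functions \<open>sc_opt\<close> are not part of
  the input, and the contents of all cells not mentioned are arbitrary. The noise powers are stored
  row by row: as users are numbered from 1 to \<open>K\<close>, distinct pairs \<open>(n, k)\<close> get distinct
  cells \<open>n * K + k\<close>.\<close>

definition holds_input :: "jspa \<Rightarrow> real \<Rightarrow> store \<Rightarrow> bool" where
  "holds_input I \<delta> s \<longleftrightarrow>
     ints s ''K'' 0 = num_users I \<and>
     ints s ''N'' 0 = num_subs I \<and>
     ints s ''M'' 0 = max_mux I \<and>
     (\<forall>k\<in>{1..num_users I}. reals s ''w'' k = weight I k) \<and>
     (\<forall>n\<in>{1..num_subs I}. reals s ''W'' n = bandwidth I n) \<and>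
     (\<forall>n\<in>{1..num_subs I}. \<forall>k\<in>{1..num_users I}.
        reals s ''eta'' (n * num_users I + k) = noise I n k) \<and>
     (\<forall>n\<in>{1..num_subs I}. reals s ''Plim'' n = power_limit I n) \<and>
     reals s ''Pmax'' 0 = power_budget I \<and>
     reals s ''delta'' 0 = \<delta>"

definition power_vector :: "store \<Rightarrow> nat \<Rightarrow> real" where
  "power_vector s n = reals s ''P'' n"

end

theory Submission
  imports Defs
begin

text \<open>
  On a subcarrier write \<open>\<Phi>\<^sub>k(t) = W w\<^sub>k log\<^sub>2 (t + \<eta>\<^sub>k)\<close> for user \<open>k\<close>. Summation by parts turns the
  single-carrier objective into \<open>\<Sum>\<^sub>i \<Phi>\<^bsub>\<pi>(i)\<^esub>(x\<^sub>i) - \<Phi>\<^bsub>\<pi>(i)\<^esub>(x\<^sub>i\<^sub>+\<^sub>1)\<close>: the power axis is cut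
  into intervals, each interval is given to one user, and at most \<open>M\<close> users occur. So the problem is
  to cover an initial segment \<open>[0, p]\<close> by a chain of at most \<open>M\<close> intervals, with noise decreasing
  towards 0.

  Everything rests on one property of two users \<open>e\<close>, \<open>b\<close> with \<open>\<eta>\<^sub>e \<le> \<eta>\<^sub>b\<close>: the function
  \<open>\<Phi>\<^sub>e - \<Phi>\<^sub>b\<close> either increases, or increases up to an explicit peak and decreases afterwards
  (\<open>gain_quasiconcave\<close>, \<open>gain_le_switch\<close>). It has three consequences.

  \<^item> Chains may be extended by any user, regardless of the order of the noise powers, without losing
    value, at the price of one interval (\<open>chain_insert\<close>). Hence no sorting is needed and
    ties between noise powers do not matter.
  \<^item> Let \<open>x\<close> be the best point of the whole range \<open>[0, P\<^sub>m\<^sub>a\<^sub>x]\<close> at which user \<open>b\<close> takes over from a chain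
    with \<open>m\<close> intervals of less noisy users. An optimal chain for any budget \<open>p\<close> can be chosen such
    that its top user takes over at his best point, which then does not exceed \<open>p\<close>
    (\<open>chain_top_user\<close>). If the best point of the top user were beyond \<open>p\<close>, then either the chain
    reaching that point, cut off at \<open>p\<close>, is already as good, or one of its users beats the top user
    beyond \<open>p\<close> and, by quasiconcavity, also before \<open>p\<close>; in both cases the top user can be replaced
    by a less noisy one.
  \<^item> Therefore the best points for \<open>m + 1\<close> follow from those for \<open>m\<close> with one clamped peak for each
    pair of users (\<open>optimal_entry_Suc\<close>), at cost \<open>O(M K\<^sup>2)\<close>. Afterwards each value
    \<open>F\<^sup>n(l \<delta>)\<close> is a maximum over \<open>K\<close> numbers (\<open>sc_opt_eqI\<close>).

  The budgets are distributed by the usual knapsack recursion over the subcarriers, with \<open>J + 1\<close>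
  levels and \<open>O(J\<^sup>2)\<close> candidates per subcarrier, followed by backtracking. The program is verified with
  a weakest-precondition calculus in which postconditions also speak about the cost.
\<close>

section \<open>Selecting the best candidate\<close>

text \<open>A candidate is a value together with the decision leading to it.\<close>

definition best_of :: "(real \<times> 'c) set \<Rightarrow> real \<times> 'c \<Rightarrow> bool" where
  "best_of S y \<longleftrightarrow> y \<in> S \<and> (\<forall>z\<in>S. fst z \<le> fst y)"

text \<open>The variant without a decision.\<close>

definition max_of :: "real set \<Rightarrow> real \<Rightarrow> bool" where
  "max_of S v \<longleftrightarrow> v \<in> S \<and> (\<forall>z\<in>S. z \<le> v)"

lemma best_of_insert:
  assumes "best_of S (d, x)"
  shows "v \<le> d \<Longrightarrow> best_of (insert (v, t) S) (d, x)"
    and "d < v \<Longrightarrow> best_of (insert (v, t) S) (v, t)"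
  using assms by (force simp: best_of_def)+

section \<open>Differences of weighted logarithms\<close>

text \<open>One subcarrier: \<open>u\<close> are the weights multiplied by the bandwidth, \<open>h\<close> the noise powers and
  \<open>B\<close> is an upper bound for all budgets considered.\<close>

locale single_carrier =
  fixes K :: nat and u h :: "nat \<Rightarrow> real" and B :: real
  assumes u_pos: "k \<in> {1..K} \<Longrightarrow> 0 < u k"
    and h_pos: "k \<in> {1..K} \<Longrightarrow> 0 < h k"
    and B_nonneg: "0 \<le> B"
begin

definition util :: "nat \<Rightarrow> real \<Rightarrow> real" where
  "util k t = u k * log 2 (t + h k)"

text \<open>The increase of the gain over an interval is the advantage of giving this interval to user \<open>e\<close>
  instead of \<open>b\<close>.\<close>

definition gain :: "nat \<Rightarrow> nat \<Rightarrow> real \<Rightarrow> real" where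
  "gain e b t = util e t - util b t"

text \<open>The zero of the derivative of the gain, used only if \<open>u e < u b\<close>. It can be negative.\<close>

definition peak :: "nat \<Rightarrow> nat \<Rightarrow> real" where
  "peak e b = (u e * h b - u b * h e) / (u b - u e)"

lemma util_mono:
  assumes "k \<in> {1..K}" "0 \<le> s" "s \<le> t"
  shows "util k s \<le> util k t"
proof -
  have "log 2 (s + h k) \<le> log 2 (t + h k)"
    using h_pos[OF assms(1)] assms by (subst log_le_cancel_iff) auto
  then show ?thesis
    using u_pos[OF assms(1)] by (simp add: util_def)
qed

lemma gain_has_derivative:
  assumes "e \<in> {1..K}" "b \<in> {1..K}" "0 \<le> t"
  shows "(gain e b has_real_derivative
           (u e * (t + h b) - u b * (t + h e)) / ((t + h e) * (t + h b) * ln 2)) (at t)"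
proof -
  have pos: "0 < t + h e" "0 < t + h b"
    using h_pos[OF assms(1)] h_pos[OF assms(2)] assms(3) by linarith+
  have util: "(util k has_real_derivative u k / ((t + h k) * ln 2)) (at t)" if "0 < t + h k" for k
    unfolding util_def using that by (auto intro!: derivative_eq_intros)
  have "a / (x * l) - c / (y * l) = (a * y - c * x) / (x * y * l)"
    if "0 < x" "0 < y" "0 < l" for a c x y l :: real
    using that by (simp add: field_simps)
  from this[OF pos, of "ln 2" "u e" "u b"] show ?thesis
    unfolding gain_def using DERIV_diff[OF util util, OF pos] by simp
qed

lemma gain_increasing:
  assumes "e \<in> {1..K}" "b \<in> {1..K}" "0 \<le> s" "s \<le> t"
    and "\<And>x. s \<le> x \<Longrightarrow> x \<le> t \<Longrightarrow> u b * (x + h e) \<le> u e * (x + h b)"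
  shows "gain e b s \<le> gain e b t"
proof (rule DERIV_nonneg_imp_nondecreasing[OF assms(4)])
  fix x assume x: "s \<le> x" "x \<le> t"
  have "0 < x + h e" "0 < x + h b"
    using h_pos[OF assms(1)] h_pos[OF assms(2)] assms(3) x by linarith+
  then have "0 \<le> (u e * (x + h b) - u b * (x + h e)) / ((x + h e) * (x + h b) * ln 2)"
    using assms(5)[OF x] by simp
  then show "\<exists>y. (gain e b has_real_derivative y) (at x) \<and> 0 \<le> y"
    using gain_has_derivative[OF assms(1,2), of x] assms(3) x by fastforce
qed

lemma gain_decreasing:
  assumes "e \<in> {1..K}" "b \<in> {1..K}" "0 \<le> s" "s \<le> t"
    and "\<And>x. s \<le> x \<Longrightarrow> x \<le> t \<Longrightarrow> u e * (x + h b) \<le> u b * (x + h e)"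
  shows "gain e b t \<le> gain e b s"
proof -
  have "gain b e s \<le> gain b e t"
    using assms by (intro gain_increasing) auto
  then show ?thesis by (simp add: gain_def)
qed

lemma gain_mono_heavier:
  assumes "e \<in> {1..K}" "b \<in> {1..K}" "h e \<le> h b" "u b \<le> u e" "0 \<le> s" "s \<le> t"
  shows "gain e b s \<le> gain e b t"
proof (rule gain_increasing[OF assms(1,2,5,6)])
  fix x assume "s \<le> x"
  then show "u b * (x + h e) \<le> u e * (x + h b)"
    using assms u_pos[OF assms(2)] h_pos[OF assms(1)] by (intro mult_mono) auto
qed

lemma gain_mono_below_peak:
  assumes "e \<in> {1..K}" "b \<in> {1..K}" "u e < u b" "0 \<le> s" "s \<le> t" "t \<le> peak e b"
  shows "gain e b s \<le> gain e b t"
proof (rule gain_increasing[OF assms(1,2,4,5)])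
  fix x assume "x \<le> t"
  then have "x \<le> peak e b" using assms by simp
  then show "u b * (x + h e) \<le> u e * (x + h b)"
    using assms(3) by (simp add: peak_def pos_le_divide_eq algebra_simps)
qed

lemma gain_antimono_above_peak:
  assumes "e \<in> {1..K}" "b \<in> {1..K}" "u e < u b" "0 \<le> s" "s \<le> t" "peak e b \<le> s"
  shows "gain e b t \<le> gain e b s"
proof (rule gain_decreasing[OF assms(1,2,4,5)])
  fix x assume "s \<le> x"
  then have "peak e b \<le> x" using assms by simp
  then show "u e * (x + h b) \<le> u b * (x + h e)"
    using assms(3) by (simp add: peak_def pos_divide_le_eq algebra_simps)
qed

lemma gain_quasiconcave:
  assumes "e \<in> {1..K}" "b \<in> {1..K}" "h e \<le> h b" "0 \<le> s" "s \<le> t" "t \<le> r"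
  shows "gain e b s \<le> gain e b t \<or> gain e b r \<le> gain e b t"
proof (cases "u b \<le> u e")
  case True
  then show ?thesis using gain_mono_heavier[OF assms(1-3) True assms(4,5)] by simp
next
  case False
  then show ?thesis
    using gain_mono_below_peak[OF assms(1,2) _ assms(4,5)]
      gain_antimono_above_peak[OF assms(1,2), of t r] assms
    by (cases "t \<le> peak e b") auto
qed

text \<open>The best point in \<open>[x, B]\<close> for user \<open>b\<close> to take over from a less noisy user \<open>e\<close>. Without a peak
  the gain of \<open>e\<close> increases throughout.\<close>

definition switch :: "nat \<Rightarrow> nat \<Rightarrow> real \<Rightarrow> real" where
  "switch e b x = (if u e < u b then max x (min (peak e b) B) else B)"

lemma switch_bounds:
  assumes "0 \<le> x" "x \<le> B"
  shows "x \<le> switch e b x" "switch e b x \<le> B"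
  using assms by (auto simp: switch_def)

lemma gain_le_switch:
  assumes "e \<in> {1..K}" "b \<in> {1..K}" "h e \<le> h b" "0 \<le> x" "x \<le> t" "t \<le> B"
  shows "gain e b t \<le> gain e b (switch e b x)"
proof (cases "u e < u b")
  case False
  then show ?thesis using gain_mono_heavier[OF assms(1-3), of t B] assms by (simp add: switch_def)
next
  case True
  show ?thesis
  proof (cases "t \<le> switch e b x")
    case le: True
    show ?thesis
    proof (cases "switch e b x \<le> peak e b")
      case True
      show ?thesis
        by (rule gain_mono_below_peak[OF assms(1,2) \<open>u e < u b\<close> _ le True]) (use assms in simp)
    next
      case False
      then have "t = x" "switch e b x = x"
        using \<open>u e < u b\<close> le assms by (auto simp: switch_def max_def min_def split: if_splits)
      then show ?thesis by simp
    qed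
  next
    case False
    then have "peak e b \<le> switch e b x" "0 \<le> switch e b x"
      using \<open>u e < u b\<close> assms by (auto simp: switch_def max_def min_def split: if_splits)
    then show ?thesis
      using gain_antimono_above_peak[OF assms(1,2) \<open>u e < u b\<close>, of "switch e b x" t] False by simp
  qed
qed

section \<open>Chains of users\<close>

text \<open>\<open>chain m r t v\<close>: the segment \<open>[0, t]\<close> is covered by at most \<open>m\<close> consecutive intervals whose
  users have noise powers below \<open>r\<close>, strictly increasing with the power; \<open>v\<close> is the total value. The
  interval added last is the topmost one.\<close>

inductive chain :: "nat \<Rightarrow> real \<Rightarrow> real \<Rightarrow> real \<Rightarrow> bool" where
  nil: "chain m r 0 0"
| piece: "chain m (h e) s v \<Longrightarrow> e \<in> {1..K} \<Longrightarrow> h e < r \<Longrightarrow> s \<le> t \<Longrightarrow>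
    chain (Suc m) r t (v + util e t - util e s)"

lemma chain_nonneg: "chain m r t v \<Longrightarrow> 0 \<le> t"
  by (induction rule: chain.induct) auto

lemma chain_at_0: "chain m r t v \<Longrightarrow> t = 0 \<Longrightarrow> v = 0"
  by (induction rule: chain.induct) (use chain_nonneg in force)+

lemma chain_mono:
  assumes "chain m r t v" "m \<le> m'" "r \<le> r'"
  shows "chain m' r' t v"
  using assms
proof (induction arbitrary: m' r' rule: chain.induct)
  case (nil m r)
  show ?case by (rule chain.nil)
next
  case (piece m e s v r t)
  obtain m'' where m': "m' = Suc m''" using piece.prems by (cases m') auto
  have "chain m'' (h e) s v" using piece.IH[of m'' "h e"] piece.prems m' by simp
  then show ?case unfolding m'
    by (rule chain.piece) (use piece in auto)
qed

text \<open>The new top user may violate the order of the noise powers. By quasiconcavity either the old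
  top user is at least as good on the new interval or the new user on the old one, and the intervals can be
  merged. In the second case the new user may collide with the next interval below, hence the induction.\<close>

lemma chain_insert:
  assumes "chain m r s v" "e \<in> {1..K}" "h e < r" "s \<le> t"
  shows "\<exists>v'. chain (Suc m) r t v' \<and> v + util e t - util e s \<le> v'"
  using assms
proof (induction arbitrary: t rule: chain.induct)
  case (nil m r)
  then have "chain (Suc m) r t (0 + util e t - util e 0)"
    by (intro chain.piece chain.nil) auto
  then show ?case by auto
next
  case (piece m a q v r s)
  have q: "0 \<le> q" using piece.hyps chain_nonneg by blast
  show ?case
  proof (cases "h a < h e")
    case True
    then have "chain (Suc m) (h e) s (v + util a s - util a q)"
      using piece.hyps by (intro chain.piece) auto
    then have "chain (Suc (Suc m)) r t ((v + util a s - util a q) + util e t - util e s)"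
      by (rule chain.piece) (use piece.prems in auto)
    then show ?thesis by auto
  next
    case False
    consider "gain e a t \<le> gain e a s" | "gain e a q \<le> gain e a s"
      using gain_quasiconcave[of e a q s t] False piece.prems piece.hyps q by auto
    then show ?thesis
    proof cases
      case 1
      have "chain (Suc m) r t (v + util a t - util a q)"
        using piece by (intro chain.piece) auto
      then have "chain (Suc (Suc m)) r t (v + util a t - util a q)"
        by (rule chain_mono) auto
      then show ?thesis using 1 by (auto simp: gain_def)
    next
      case 2
      obtain v' where v': "chain (Suc m) r t v'" "v + util e t - util e q \<le> v'"
      proof (cases "h e < h a")
        case True
        then obtain v' where "chain (Suc m) (h a) t v'" "v + util e t - util e q \<le> v'"
          using piece.IH[of t] piece.prems piece.hyps by auto
        then show ?thesis using that chain_mono[of "Suc m" "h a" t v' "Suc m" r] piece.hyps by simp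
      next
        case F: False
        then have "h e = h a" using False by simp
        then have "chain (Suc m) r t (v + util e t - util e q)"
          using piece by (intro chain.piece) auto
        then show ?thesis using that by blast
      qed
      have "chain (Suc (Suc m)) r t v'" using v'(1) by (rule chain_mono) auto
      then show ?thesis using 2 v' by (auto simp: gain_def intro!: exI[of _ v'])
    qed
  qed
qed

text \<open>Cutting a chain off at \<open>p\<close> loses no more than user \<open>b\<close> earns between \<open>p\<close> and \<open>x\<close>, unless some
  user of the chain beats \<open>b\<close> on an interval above \<open>p\<close>.\<close>

lemma chain_truncate:
  assumes "chain m r x v" "0 \<le> p" "p \<le> x"
  shows "\<exists>v'. chain m r p v' \<and>
    (v - v' \<le> util b x - util b p \<or>
     (\<exists>e\<in>{1..K}. h e < r \<and> (\<exists>s t. p \<le> s \<and> s \<le> t \<and> gain e b s < gain e b t)))"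
  using assms
proof (induction rule: chain.induct)
  case (nil m r)
  then have "p = 0" by simp
  then show ?case using chain.nil[of m r] by (auto intro!: exI[of _ 0])
next
  case (piece m e s v r t)
  show ?case
  proof (cases "s \<le> p")
    case True
    have "chain (Suc m) r p (v + util e p - util e s)"
      using piece True by (intro chain.piece) auto
    moreover have "util e t - util e p \<le> util b t - util b p \<or> gain e b p < gain e b t"
      by (auto simp: gain_def)
    ultimately show ?thesis
      using piece.hyps piece.prems
      by (intro exI[of _ "v + util e p - util e s"]) auto
  next
    case False
    then obtain v' where v': "chain m (h e) p v'"
      "v - v' \<le> util b s - util b p \<or>
       (\<exists>a\<in>{1..K}. h a < h e \<and> (\<exists>s t. p \<le> s \<and> s \<le> t \<and> gain a b s < gain a b t))"
      using piece by auto
    have "chain (Suc m) r p v'"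
      using v'(1) by (rule chain_mono) (use piece.hyps in auto)
    moreover have "util e t - util e s \<le> util b t - util b s \<or> gain e b s < gain e b t"
      by (auto simp: gain_def)
    moreover have "\<exists>s t. p \<le> s \<and> s \<le> t \<and> gain e b s < gain e b t" if "gain e b s < gain e b t"
      using that False piece.hyps by (intro exI[of _ s] exI[of _ t]) auto
    moreover have "h a < r" if "h a < h e" for a
      using that piece.hyps by simp
    ultimately show ?thesis
      using v'(2) piece.hyps by (smt (verit))
  qed
qed

section \<open>Recursion for the best entry points\<close>

text \<open>Among all chains that end at or before \<open>B\<close> and consist of at most \<open>m\<close> intervals of users less noisy
  than \<open>b\<close>, the one to be continued by \<open>b\<close> ends best at \<open>x\<close>, and \<open>d\<close> is its value
  diminished by \<open>util b x\<close>. A chain continued by \<open>b\<close> up to \<open>p\<close> then has value \<open>d + util b p\<close>.\<close>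

definition optimal_entry :: "nat \<Rightarrow> nat \<Rightarrow> real \<Rightarrow> real \<Rightarrow> bool" where
  "optimal_entry m b d x \<longleftrightarrow> 0 \<le> x \<and> x \<le> B \<and> chain m (h b) x (d + util b x) \<and>
     (\<forall>t v. chain m (h b) t v \<longrightarrow> t \<le> B \<longrightarrow> v - util b t \<le> d)"

text \<open>The entry point of a user is optimized over the whole range up to \<open>B\<close>, not just up to \<open>p\<close>. Still,
  one of the users whose entry point happens to lie below \<open>p\<close> yields an optimal chain for \<open>p\<close>.\<close>

lemma chain_top_user:
  assumes opt: "\<And>e. e \<in> {1..K} \<Longrightarrow> optimal_entry m e (D e) (X e)"
    and c: "chain (Suc m) r p v" and p: "0 < p" "p \<le> B"
  shows "\<exists>e\<in>{1..K}. h e < r \<and> X e \<le> p \<and> v \<le> D e + util e p"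
proof -
  define \<mu> where "\<mu> r = card {k\<in>{1..K}. h k < r}" for r
  have less: "\<mu> (h e) < \<mu> r" if "e \<in> {1..K}" "h e < r" for e r
    unfolding \<mu>_def by (rule psubset_card_mono) (use that in auto)
  \<comment> \<open>A top user who enters too late is replaced by a less noisy one; \<open>\<mu>\<close> makes this terminate.\<close>
  from c show ?thesis
  proof (induction "\<mu> r" arbitrary: r v rule: less_induct)
    case less_r: less
    from less_r.prems obtain e s v0 where e: "chain m (h e) s v0" "e \<in> {1..K}" "h e < r" "s \<le> p"
      "v = v0 + util e p - util e s"
      using p by (cases rule: chain.cases) auto
    have oe: "optimal_entry m e (D e) (X e)" using opt e(2) .
    have d: "v0 - util e s \<le> D e"
      using oe e p by (auto simp: optimal_entry_def)
    have smaller: ?case if "chain (Suc m) (h e) p v'" "v \<le> v'" for v'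
    proof -
      have "\<exists>a\<in>{1..K}. h a < h e \<and> X a \<le> p \<and> v' \<le> D a + util a p"
        using less_r.hyps[OF less[OF e(2,3)] that(1)] .
      then obtain a where "a \<in> {1..K}" "h a < h e" "X a \<le> p" "v' \<le> D a + util a p" by blast
      then show ?thesis using that(2) e(3) by (intro bexI[of _ a]) auto
    qed
    show ?case
    proof (cases "X e \<le> p")
      case True
      then show ?thesis using d e by (intro bexI[of _ e]) auto
    next
      case False
      obtain v' where v': "chain m (h e) p v'"
        "D e + util e (X e) - v' \<le> util e (X e) - util e p \<or>
          (\<exists>a\<in>{1..K}. h a < h e \<and> (\<exists>s t. p \<le> s \<and> s \<le> t \<and> gain a e s < gain a e t))"
        using chain_truncate[of m "h e" "X e" "D e + util e (X e)" p e] oe False p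
        by (auto simp: optimal_entry_def)
      from v'(2) show ?thesis
      proof
        assume "D e + util e (X e) - v' \<le> util e (X e) - util e p"
        then have "v \<le> v'" using d e(5) by simp
        moreover have "chain (Suc m) (h e) p v'" using v'(1) by (rule chain_mono) auto
        ultimately show ?thesis by (rule smaller[rotated])
      next
        assume "\<exists>a\<in>{1..K}. h a < h e \<and> (\<exists>s t. p \<le> s \<and> s \<le> t \<and> gain a e s < gain a e t)"
        then obtain a q t where a: "a \<in> {1..K}" "h a < h e" "p \<le> q" "q \<le> t" "gain a e q < gain a e t"
          by auto
        have s0: "0 \<le> s" using e(1) chain_nonneg by blast
        have "gain a e s \<le> gain a e p"
          using gain_quasiconcave[of a e s p t] gain_quasiconcave[of a e p q t] a e s0 p by auto
        then have "v \<le> v0 + util a p - util a s" using e(5) by (auto simp: gain_def)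
        then show ?thesis
          using chain_insert[OF e(1) a(1,2) e(4)] smaller by force
      qed
    qed
  qed
qed

text \<open>The entries offered to user \<open>b\<close> after the users \<open>1, \<dots>, i\<close> have been considered: start at power
  0, or take over from a less noisy user.\<close>

definition entry_candidates ::
    "(nat \<Rightarrow> real) \<Rightarrow> (nat \<Rightarrow> real) \<Rightarrow> nat \<Rightarrow> nat \<Rightarrow> (real \<times> real) set" where
  "entry_candidates D X b i = insert (- util b 0, 0)
     {(D e + gain e b (switch e b (X e)), switch e b (X e)) | e. e \<in> {1..i} \<and> h e < h b}"

lemma optimal_entry_0: "optimal_entry 0 b (- util b 0) 0"
  using B_nonneg by (auto simp: optimal_entry_def intro: chain.nil elim: chain.cases)

lemma optimal_entry_Suc:
  assumes opt: "\<And>e. e \<in> {1..K} \<Longrightarrow> optimal_entry m e (D e) (X e)"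
    and b: "b \<in> {1..K}" and best: "best_of (entry_candidates D X b K) (d, x)"
  shows "optimal_entry (Suc m) b d x"
proof -
  have mem: "(d, x) \<in> entry_candidates D X b K"
    and max: "\<And>z. z \<in> entry_candidates D X b K \<Longrightarrow> fst z \<le> d"
    using best by (auto simp: best_of_def)
  have "0 \<le> x \<and> x \<le> B \<and> chain (Suc m) (h b) x (d + util b x)"
  proof (cases "(d, x) = (- util b 0, 0)")
    case True
    then show ?thesis using B_nonneg by (auto intro: chain.nil)
  next
    case False
    then obtain e where e: "e \<in> {1..K}" "h e < h b" "x = switch e b (X e)" "d = D e + gain e b x"
      using mem by (auto simp: entry_candidates_def)
    have oe: "0 \<le> X e" "X e \<le> B" "chain m (h e) (X e) (D e + util e (X e))"
      using opt[OF e(1)] by (auto simp: optimal_entry_def)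
    have "X e \<le> x" "x \<le> B" using switch_bounds[OF oe(1,2)] e(3) by auto
    moreover from this have "chain (Suc m) (h b) x (D e + util e (X e) + util e x - util e (X e))"
      using oe e by (intro chain.piece) auto
    ultimately show ?thesis using oe e(4) by (simp add: gain_def)
  qed
  moreover have "v - util b t \<le> d" if c: "chain (Suc m) (h b) t v" and t: "t \<le> B" for t v
  proof (cases "0 < t")
    case True
    obtain e where e: "e \<in> {1..K}" "h e < h b" "X e \<le> t" "v \<le> D e + util e t"
      using chain_top_user[OF opt c True t] by auto
    have "0 \<le> X e" using opt[OF e(1)] by (simp add: optimal_entry_def)
    then have "gain e b t \<le> gain e b (switch e b (X e))"
      using e b t by (intro gain_le_switch) auto
    moreover have "D e + gain e b (switch e b (X e)) \<le> d"
      using max[of "(D e + gain e b (switch e b (X e)), switch e b (X e))"] e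
      by (auto simp: entry_candidates_def)
    ultimately show ?thesis using e(4) by (simp add: gain_def)
  next
    case False
    have "t = 0" using chain_nonneg[OF c] False by simp
    then show ?thesis using chain_at_0[OF c] max[of "(- util b 0, 0)"]
      by (auto simp: entry_candidates_def)
  qed
  ultimately show ?thesis by (simp add: optimal_entry_def)
qed

text \<open>The values offered for budget \<open>p\<close> by the users \<open>1, \<dots>, i\<close>; the value 0 belongs to no power at
  all.\<close>

definition value_candidates ::
    "(nat \<Rightarrow> real) \<Rightarrow> (nat \<Rightarrow> real) \<Rightarrow> real \<Rightarrow> nat \<Rightarrow> real set" where
  "value_candidates D X p i = insert 0 {D b + util b p | b. b \<in> {1..i} \<and> X b \<le> p}"

lemma value_candidates_achievable:
  assumes opt: "\<And>e. e \<in> {1..K} \<Longrightarrow> optimal_entry m e (D e) (X e)"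
    and r: "\<And>e. e \<in> {1..K} \<Longrightarrow> h e < r" and p: "0 \<le> p"
    and v: "v \<in> value_candidates D X p K"
  shows "\<exists>t\<le>p. chain (Suc m) r t v"
proof (cases "v = 0")
  case True
  then show ?thesis using p chain.nil by auto
next
  case False
  then obtain b where b: "b \<in> {1..K}" "X b \<le> p" "v = D b + util b p"
    using v by (auto simp: value_candidates_def)
  have "chain m (h b) (X b) (D b + util b (X b))" using opt[OF b(1)] by (simp add: optimal_entry_def)
  then have "chain (Suc m) r p (D b + util b (X b) + util b p - util b (X b))"
    using b r by (intro chain.piece) auto
  then show ?thesis using b by auto
qed

lemma chain_le_best_value:
  assumes opt: "\<And>e. e \<in> {1..K} \<Longrightarrow> optimal_entry m e (D e) (X e)"
    and p: "p \<le> B" and c: "chain (Suc m) r t w" "t \<le> p"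
    and v: "\<And>z. z \<in> value_candidates D X p K \<Longrightarrow> z \<le> v"
  shows "w \<le> v"
  using c(1)
proof (cases rule: chain.cases)
  case nil
  then show ?thesis using v[of 0] by (simp add: value_candidates_def)
next
  case (piece e s v0)
  have s0: "0 \<le> s" using piece chain_nonneg by blast
  have "chain (Suc m) r p (v0 + util e p - util e s)"
    using piece c by (intro chain.piece) auto
  moreover have le: "w \<le> v0 + util e p - util e s"
    using util_mono[of e t p] piece s0 c by auto
  ultimately show ?thesis
  proof (cases "0 < p")
    case True
    from chain_top_user[OF opt _ True p, of r "v0 + util e p - util e s"] obtain b where
      "b \<in> {1..K}" "X b \<le> p" "v0 + util e p - util e s \<le> D b + util b p"
      using \<open>chain (Suc m) r p _\<close> by auto
    moreover from this have "D b + util b p \<le> v"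
      by (intro v) (auto simp: value_candidates_def)
    ultimately show ?thesis using le by linarith
  next
    case False
    have "t = 0" using False c(2) s0 piece by simp
    then show ?thesis using chain_at_0[OF c(1)] v[of 0] by (simp add: value_candidates_def)
  qed
qed

end

section \<open>Allocations and chains\<close>

context single_carrier
begin

text \<open>Thanks to \<open>chain_insert\<close>, the users of the allocation may come in any order.\<close>

lemma chain_of_allocation:
  assumes p: "\<And>i. i \<in> {1..K} \<Longrightarrow> p i \<in> {1..K}" and r: "\<And>k. k \<in> {1..K} \<Longrightarrow> h k < r"
    and x: "\<And>i. i \<in> {1..K} \<Longrightarrow> x (i + 1) \<le> x i" "x (K + 1) = 0"
    and j: "1 \<le> j" "j \<le> K + 1"
  shows "\<exists>v. chain (card {i \<in> {j..K}. x i > x (i + 1)}) r (x j) v \<and>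
    (\<Sum>i=j..K. util (p i) (x i) - util (p i) (x (i + 1))) \<le> v"
  using j(2,1)
proof (induction rule: inc_induct)
  case base
  then show ?case using x(2) by (auto intro: chain.nil)
next
  case (step j)
  then obtain v where v: "chain (card {i \<in> {Suc j..K}. x i > x (i + 1)}) r (x (Suc j)) v"
    "(\<Sum>i=Suc j..K. util (p i) (x i) - util (p i) (x (i + 1))) \<le> v" by auto
  have j: "j \<in> {1..K}" using step by simp
  have iv: "{j..K} = insert j {Suc j..K}" using j by auto
  have sum: "(\<Sum>i=j..K. util (p i) (x i) - util (p i) (x (i + 1))) =
    (util (p j) (x j) - util (p j) (x (Suc j))) +
    (\<Sum>i=Suc j..K. util (p i) (x i) - util (p i) (x (i + 1)))"
    unfolding iv by simp
  show ?case
  proof (cases "x j > x (Suc j)")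
    case True
    have "{i \<in> {j..K}. x i > x (i + 1)} = insert j {i \<in> {Suc j..K}. x i > x (i + 1)}"
      using True unfolding iv by auto
    then have card: "card {i \<in> {j..K}. x i > x (i + 1)} =
      Suc (card {i \<in> {Suc j..K}. x i > x (i + 1)})" by simp
    obtain v' where "chain (Suc (card {i \<in> {Suc j..K}. x i > x (i + 1)})) r (x j) v'"
      "v + util (p j) (x j) - util (p j) (x (Suc j)) \<le> v'"
      using chain_insert[OF v(1) p[OF j] r[OF p[OF j]], of "x j"] x(1)[OF j] by auto
    then show ?thesis unfolding card sum using v(2) by (intro exI[of _ v']) auto
  next
    case False
    then have eq: "x (Suc j) = x j" using x(1)[OF j] by simp
    have "{i \<in> {j..K}. x i > x (i + 1)} = {i \<in> {Suc j..K}. x i > x (i + 1)}"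
      using False unfolding iv by auto
    then show ?thesis using v eq unfolding sum by auto
  qed
qed

text \<open>The condition on users at least as noisy as \<open>r\<close> says that these share the topmost power level, so
  that the level can be raised without creating a further step.\<close>

lemma allocation_of_chain:
  assumes p: "p permutes {1..K}"
    and ord: "\<And>i j. i \<in> {1..K} \<Longrightarrow> j \<in> {1..K} \<Longrightarrow> i \<le> j \<Longrightarrow> h (p j) \<le> h (p i)"
    and c: "chain m r t v"
  shows "\<exists>x. (\<forall>i. x (Suc i) \<le> x i) \<and> (\<forall>i. x i \<le> t) \<and> (\<forall>i>K. x i = 0) \<and>
    (\<forall>i\<in>{1..K}. r \<le> h (p i) \<longrightarrow> x i = t) \<and>
    card {i \<in> {1..K}. x i > x (i + 1)} \<le> m \<and>
    (\<Sum>i=1..K. util (p i) (x i) - util (p i) (x (i + 1))) = v"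
  using c
proof (induction rule: chain.induct)
  case (nil m r)
  show ?case by (intro exI[of _ "\<lambda>_. 0"]) auto
next
  case (piece m e s v r t)
  then obtain x where x: "\<And>i. x (Suc i) \<le> x i" "\<And>i. x i \<le> s" "\<And>i. i > K \<Longrightarrow> x i = 0"
    "\<And>i. i \<in> {1..K} \<Longrightarrow> h e \<le> h (p i) \<Longrightarrow> x i = s"
    "card {i \<in> {1..K}. x i > x (i + 1)} \<le> m"
    "(\<Sum>i=1..K. util (p i) (x i) - util (p i) (x (i + 1))) = v"
    by blast
  obtain k where k: "k \<in> {1..K}" "p k = e"
    using permutes_image[OF p] piece.hyps(2) by (metis imageE)
  have top: "x i = s" if "i \<in> {1..k}" for i
    using x(4)[of i] ord[of i k] that k by auto
  define y where "y i = (if i \<le> k then t else x i)" for i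
  have "{i \<in> {1..K}. y i > y (i + 1)} \<subseteq> insert k {i \<in> {1..K}. x i > x (i + 1)}"
    by (auto simp: y_def)
  then have "card {i \<in> {1..K}. y i > y (i + 1)} \<le> card (insert k {i \<in> {1..K}. x i > x (i + 1)})"
    by (intro card_mono) auto
  also have "\<dots> \<le> Suc m" using x(5) by (auto simp: card_insert_if)
  finally have card: "card {i \<in> {1..K}. y i > y (i + 1)} \<le> Suc m" .
  have "(\<Sum>i=1..K. util (p i) (y i) - util (p i) (y (i + 1))) =
    (\<Sum>i=1..K. (util (p i) (x i) - util (p i) (x (i + 1))) +
      (if i = k then util e t - util e s else 0))"
    by (rule sum.cong) (use top k in \<open>auto simp: y_def\<close>)
  also have "\<dots> = v + util e t - util e s"
    using x(6) k by (simp add: sum.distrib)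
  finally have sum: "(\<Sum>i=1..K. util (p i) (y i) - util (p i) (y (i + 1))) =
    v + util e t - util e s" .
  have "y (Suc i) \<le> y i" "y i \<le> t" for i
    using x(1)[of i] x(2)[of i] x(2)[of "Suc i"] piece.hyps(4) by (auto simp: y_def)
  moreover have "y i = 0" if "i > K" for i
    using that x(3) k by (auto simp: y_def)
  moreover have "y i = t" if "i \<in> {1..K}" "r \<le> h (p i)" for i
    using that ord[of k i] k piece.hyps(3) by (cases "i \<le> k") (auto simp: y_def)
  ultimately show ?case using card sum by (intro exI[of _ y]) auto
qed

end

text \<open>A subcarrier of a problem instance.\<close>

locale subcarrier = single_carrier "num_users I" "\<lambda>k. bandwidth I n * weight I k" "noise I n" B
  for I :: jspa and n :: nat and B :: real +
  fixes \<pi> :: "nat \<Rightarrow> nat \<Rightarrow> nat"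
  assumes valid: "valid_jspa I" and orders: "decoding_orders I \<pi>" and n: "n \<in> {1..num_subs I}"
begin

text \<open>Summation by parts.\<close>

lemma sum_rate_terms:
  assumes "1 \<le> k"
  shows "(\<Sum>i=1..k. rate_term I \<pi> n i (x i)) =
    (\<Sum>i=1..k. util (\<pi> n i) (x i) - util (\<pi> n i) (x (i + 1))) + util (\<pi> n k) (x (k + 1))"
  using assms
proof (induction rule: dec_induct)
  case base
  show ?case by (simp add: rate_term_def util_def)
next
  case (step k)
  then show ?case by (simp add: rate_term_def util_def algebra_simps)
qed

lemma sc_value_eq_sum_util:
  assumes "x (num_users I + 1) = 0"
  shows "sc_value I \<pi> n x =
    (\<Sum>i=1..num_users I. util (\<pi> n i) (x i) - util (\<pi> n i) (x (i + 1)))"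
proof -
  have K: "1 \<le> num_users I" using valid by (simp add: valid_jspa_def)
  then have "\<pi> n (num_users I) \<in> {1..num_users I}"
    using orders n permutes_in_image[of "\<pi> n" "{1..num_users I}" "num_users I"]
    by (simp add: decoding_orders_def)
  then have "0 < noise I n (\<pi> n (num_users I))" by (rule h_pos)
  then show ?thesis
    using sum_rate_terms[OF K, of x] assms
    by (simp add: sc_value_def rate_offset_def util_def log_divide)
qed

lemma sc_opt_eqI:
  assumes opt: "\<And>e. e \<in> {1..num_users I} \<Longrightarrow> optimal_entry (max_mux I - 1) e (D e) (X e)"
    and p: "0 \<le> p" "p \<le> B"
    and v: "v \<in> value_candidates D X p (num_users I)"
    and max: "\<And>z. z \<in> value_candidates D X p (num_users I) \<Longrightarrow> z \<le> v"
  shows "sc_opt I \<pi> n p = v"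
proof (rule antisym)
  let ?K = "num_users I"
  have K: "1 \<le> ?K" and M: "Suc (max_mux I - 1) = max_mux I"
    using valid by (auto simp: valid_jspa_def)
  have perm: "\<pi> n permutes {1..?K}"
    and ord: "\<And>i j. i \<in> {1..?K} \<Longrightarrow> j \<in> {1..?K} \<Longrightarrow> i \<le> j \<Longrightarrow>
      noise I n (\<pi> n j) \<le> noise I n (\<pi> n i)"
    using orders n by (auto simp: decoding_orders_def)
  define r where "r = Max (noise I n ` {1..?K}) + 1"
  have r: "noise I n k < r" if "k \<in> {1..?K}" for k
  proof -
    have "noise I n k \<le> Max (noise I n ` {1..?K})" by (rule Max_ge) (use that in auto)
    then show ?thesis by (simp add: r_def)
  qed
  obtain x where x: "x \<in> sc_feasible I p" "sc_opt I \<pi> n p = sc_value I \<pi> n x"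
    "\<And>y. y \<in> sc_feasible I p \<Longrightarrow> sc_value I \<pi> n y \<le> sc_value I \<pi> n x"
    using sc_opt_attained[OF valid orders n p(1)] by blast
  show "sc_opt I \<pi> n p \<le> v"
  proof -
    have dec: "x (i + 1) \<le> x i" if "i \<in> {1..?K}" for i
      using x(1) that by (cases "i = ?K") (auto simp: sc_feasible_def)
    have x0: "x (?K + 1) = 0" and x1: "x 1 \<le> p"
      and card: "card {i \<in> {1..?K}. x i > x (i + 1)} \<le> max_mux I"
      using x(1) by (auto simp: sc_feasible_def)
    have in_range: "\<pi> n i \<in> {1..?K}" if "i \<in> {1..?K}" for i
      using permutes_in_image[OF perm] that by blast
    obtain w where w: "chain (card {i \<in> {1..?K}. x i > x (i + 1)}) r (x 1) w"
      "sc_value I \<pi> n x \<le> w"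
      using chain_of_allocation[of "\<pi> n" r x 1] in_range r dec x0 sc_value_eq_sum_util[of x, OF x0]
      by auto
    have "chain (Suc (max_mux I - 1)) r (x 1) w"
      using w(1) by (rule chain_mono) (use card M in auto)
    from chain_le_best_value[OF opt p(2) this x1 max] have "w \<le> v" by simp
    then show ?thesis using x(2) w(2) by simp
  qed
  show "v \<le> sc_opt I \<pi> n p"
  proof -
    obtain t where t: "t \<le> p" "chain (max_mux I) r t v"
      using value_candidates_achievable[OF opt r p(1) v] M by auto
    obtain y where y: "\<And>i. y (Suc i) \<le> y i" "\<And>i. y i \<le> t" "\<And>i. i > ?K \<Longrightarrow> y i = 0"
      "card {i \<in> {1..?K}. y i > y (i + 1)} \<le> max_mux I"
      "(\<Sum>i=1..?K. util (\<pi> n i) (y i) - util (\<pi> n i) (y (i + 1))) = v"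
      using allocation_of_chain[OF perm ord t(2)] by blast
    have "y \<in> sc_feasible I p"
      using y(1)[of ?K] y(1,3,4) y(2)[of 1] t(1) by (auto simp: sc_feasible_def)
    moreover have "sc_value I \<pi> n y = v"
      using sc_value_eq_sum_util[of y] y(3,5) by simp
    ultimately show ?thesis using x(2,3) by auto
  qed
qed

end

section \<open>Distributing the budget over the subcarriers\<close>

text \<open>\<open>V n l\<close> is the best total value of the subcarriers \<open>1, \<dots>, n\<close> with at most \<open>l\<close> power units, and
  \<open>ch n l\<close> the number of units given to subcarrier \<open>n\<close>.\<close>

locale knapsack =
  fixes N J :: nat and g :: "nat \<Rightarrow> nat \<Rightarrow> real" and allowed :: "nat \<Rightarrow> nat \<Rightarrow> bool"
    and V :: "nat \<Rightarrow> nat \<Rightarrow> real" and ch :: "nat \<Rightarrow> nat \<Rightarrow> nat"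
  assumes V_0: "l \<le> J \<Longrightarrow> V 0 l = 0"
    and V_Suc: "\<lbrakk>n < N; l \<le> J\<rbrakk> \<Longrightarrow>
      best_of {(V n (l - q) + g (Suc n) q, q) | q. q \<le> l \<and> allowed (Suc n) q}
        (V (Suc n) l, ch (Suc n) l)"
begin

lemma le_table:
  assumes "n \<le> N" "l \<le> J" "(\<Sum>i=1..n. q i) \<le> l" "\<And>i. i \<in> {1..n} \<Longrightarrow> allowed i (q i)"
  shows "(\<Sum>i=1..n. g i (q i)) \<le> V n l"
  using assms
proof (induction n arbitrary: l)
  case 0
  then show ?case using V_0 by simp
next
  case (Suc n)
  let ?a = "q (Suc n)"
  have "(\<Sum>i=1..n. g i (q i)) \<le> V n (l - ?a)"
    by (rule Suc.IH) (use Suc.prems in auto)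
  moreover have "V n (l - ?a) + g (Suc n) ?a \<le> V (Suc n) l"
    using V_Suc[of n l] Suc.prems by (auto simp: best_of_def)
  ultimately show ?case by simp
qed

text \<open>Backtracking: the units left after \<open>i\<close> subcarriers, starting with the last one, have been served.\<close>

primrec budget_left :: "nat \<Rightarrow> nat" where
  "budget_left 0 = J"
| "budget_left (Suc i) = budget_left i - ch (N - i) (budget_left i)"

definition choice :: "nat \<Rightarrow> nat" where
  "choice n = ch n (budget_left (N - n))"

lemma budget_left_le: "budget_left i \<le> J"
  by (induction i) auto

lemma choice_props:
  assumes "n \<le> N"
  shows "(\<Sum>i=1..n. choice i) \<le> budget_left (N - n) \<and>
    (\<Sum>i=1..n. g i (choice i)) = V n (budget_left (N - n)) \<and>
    (\<forall>i\<in>{1..n}. allowed i (choice i))"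
  using assms
proof (induction n)
  case 0
  then show ?case using V_0[OF budget_left_le] by simp
next
  case (Suc n)
  let ?l = "budget_left (N - Suc n)"
  have best: "(V (Suc n) ?l, choice (Suc n))
      \<in> {(V n (?l - q) + g (Suc n) q, q) | q. q \<le> ?l \<and> allowed (Suc n) q}"
    using V_Suc[of n ?l] budget_left_le Suc.prems by (simp add: best_of_def choice_def)
  have "N - n = Suc (N - Suc n)" "N - (N - Suc n) = Suc n" using Suc.prems by auto
  then have "budget_left (N - n) = ?l - choice (Suc n)"
    by (simp add: choice_def)
  then have IH: "(\<Sum>i=1..n. choice i) \<le> ?l - choice (Suc n)"
      "(\<Sum>i=1..n. g i (choice i)) = V n (?l - choice (Suc n))" "\<forall>i\<in>{1..n}. allowed i (choice i)"
    using Suc by auto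
  have "(\<Sum>i=1..n. choice i) + choice (Suc n) \<le> ?l"
    using IH(1) best by auto
  then show ?case using IH(2,3) best by (auto simp: le_Suc_eq)
qed

lemma choice_le:
  assumes "n \<in> {1..N}"
  shows "choice n \<le> J"
proof -
  have "choice n \<le> (\<Sum>n=1..N. choice n)" by (rule member_le_sum) (use assms in auto)
  also have "\<dots> \<le> budget_left (N - N)" using choice_props[of N] by blast
  also have "\<dots> \<le> J" by (rule budget_left_le)
  finally show ?thesis .
qed

end

lemma level_le_budget_iff:
  assumes "valid_jspa I" "0 < \<delta>"
  shows "real l * \<delta> \<le> power_budget I \<longleftrightarrow> l \<le> num_levels I \<delta>"
proof -
  have "0 \<le> power_budget I / \<delta>" using assms by (simp add: valid_jspa_def)
  then have "l \<le> num_levels I \<delta> \<longleftrightarrow> real l \<le> power_budget I / \<delta>"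
    unfolding num_levels_def by (simp add: le_nat_iff le_floor_iff)
  then show ?thesis using \<open>0 < \<delta>\<close> by (simp add: pos_le_divide_eq)
qed

text \<open>The discrete feasible set consists of the allotments of at most \<open>num_levels\<close> units of size
  \<open>\<delta>\<close>.\<close>

lemma is_arg_max_mc_objective:
  assumes "valid_jspa I" "0 < \<delta>"
    and knap: "knapsack (num_subs I) (num_levels I \<delta>) (\<lambda>n q. sc_opt I \<pi> n (real q * \<delta>))
      (\<lambda>n q. real q * \<delta> \<le> power_limit I n) V ch"
    and P: "\<And>n. n \<in> {1..num_subs I} \<Longrightarrow>
      P n = real (knapsack.choice (num_subs I) (num_levels I \<delta>) ch n) * \<delta>"
  shows "is_arg_max (mc_objective I \<pi>) (\<lambda>P. P \<in> mc_feasible_discrete I \<delta>) P"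
proof -
  interpret knapsack "num_subs I" "num_levels I \<delta>" "\<lambda>n q. sc_opt I \<pi> n (real q * \<delta>)"
    "\<lambda>n q. real q * \<delta> \<le> power_limit I n" V ch by (fact knap)
  let ?N = "num_subs I" and ?J = "num_levels I \<delta>"
  note budget = level_le_budget_iff[OF assms(1,2)]
  note c = choice_props[of ?N, simplified]
  have sum: "(\<Sum>n=1..?N. P n) = real (\<Sum>n=1..?N. choice n) * \<delta>"
    using P by (simp add: sum_distrib_right)
  have "choice n \<le> ?J" if "n \<in> {1..?N}" for n
    using choice_le[OF that] .
  then have "P \<in> mc_feasible_discrete I \<delta>"
    using P c sum budget[of "\<Sum>n=1..?N. choice n"] \<open>0 < \<delta>\<close>
    by (auto simp: mc_feasible_discrete_def mc_feasible_def)
  moreover have "mc_objective I \<pi> R \<le> mc_objective I \<pi> P" if "R \<in> mc_feasible_discrete I \<delta>" for R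
  proof -
    have "\<forall>n\<in>{1..?N}. \<exists>l. R n = real l * \<delta>"
      using that by (auto simp: mc_feasible_discrete_def)
    then obtain q where q: "\<And>n. n \<in> {1..?N} \<Longrightarrow> R n = real (q n) * \<delta>" by metis
    have "real (\<Sum>n=1..?N. q n) * \<delta> = (\<Sum>n=1..?N. R n)"
      using q by (simp add: sum_distrib_right)
    also have "\<dots> \<le> power_budget I"
      using that by (simp add: mc_feasible_discrete_def mc_feasible_def)
    finally have "(\<Sum>n=1..?N. q n) \<le> ?J" by (simp only: budget)
    moreover have "real (q n) * \<delta> \<le> power_limit I n" if "n \<in> {1..?N}" for n
      using \<open>R \<in> _\<close> q that by (fastforce simp: mc_feasible_discrete_def mc_feasible_def)
    ultimately have "(\<Sum>n=1..?N. sc_opt I \<pi> n (real (q n) * \<delta>)) \<le> V ?N ?J"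
      by (intro le_table) auto
    then show ?thesis using q P c by (simp add: mc_objective_def)
  qed
  ultimately show ?thesis by (simp add: is_arg_max_linorder)
qed

section \<open>Weakest preconditions with cost\<close>

text \<open>Total correctness: the postcondition speaks about the cost and the final store. For programs
  without loops the equations below compute the precondition by rewriting.\<close>

definition wp :: "com \<Rightarrow> (nat \<Rightarrow> store \<Rightarrow> bool) \<Rightarrow> store \<Rightarrow> bool" where
  "wp c Q s \<longleftrightarrow> (\<exists>t s'. exec c s t s' \<and> Q t s')"

lemma wp_Skip [simp]: "wp Skip Q s \<longleftrightarrow> Q 1 s"
  unfolding wp_def using exec.Skip exec_SkipE by metis

lemma wp_ISet [simp]:
  "wp (ISet a d e) Q s \<longleftrightarrow> Q (1 + icost d + icost e) (iupd a (ival d s) (ival e s) s)"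
  unfolding wp_def using exec.ISet exec_ISetE by metis

lemma wp_RSet [simp]:
  "wp (RSet a d e) Q s \<longleftrightarrow> Q (1 + icost d + rcost e) (rupd a (ival d s) (rval e s) s)"
  unfolding wp_def using exec.RSet exec_RSetE by metis

lemma wp_Seq [simp]: "wp (Seq c c') Q s \<longleftrightarrow> wp c (\<lambda>t. wp c' (\<lambda>t'. Q (t + t'))) s"
  unfolding wp_def by (blast intro: exec.Seq elim: exec_SeqE)

lemma wp_If [simp]:
  "wp (If b c c') Q s \<longleftrightarrow>
    (if tval b s then wp c (\<lambda>t. Q (tcost b + t)) s else wp c' (\<lambda>t. Q (tcost b + t)) s)"
  unfolding wp_def by (cases "tval b s") (auto intro: exec.IfTrue exec.IfFalse elim!: exec_IfE)

lemma wp_mono: "wp c Q s \<Longrightarrow> (\<And>t s'. Q t s' \<Longrightarrow> R t s') \<Longrightarrow> wp c R s"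
  unfolding wp_def by blast

lemma wp_While_step:
  assumes "tval b s" "wp c (\<lambda>t. wp (While b c) (\<lambda>t'. Q (tcost b + t + t'))) s"
  shows "wp (While b c) Q s"
  using assms unfolding wp_def by (blast intro: exec.WhileTrue)

lemma wp_While_stop: "\<not> tval b s \<Longrightarrow> Q (tcost b) s \<Longrightarrow> wp (While b c) Q s"
  unfolding wp_def by (blast intro: exec.WhileFalse)

text \<open>The invariant is indexed by the number of passes, which is known in advance to be \<open>n\<close>.\<close>

lemma wp_While:
  assumes "Inv 0 s"
    and step: "\<And>i s. i < n \<Longrightarrow> Inv i s \<Longrightarrow> tval b s \<and> wp c (\<lambda>t s'. t \<le> T \<and> Inv (Suc i) s') s"
    and stop: "\<And>s. Inv n s \<Longrightarrow> \<not> tval b s"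
  shows "wp (While b c) (\<lambda>t s'. t \<le> n * (tcost b + T) + tcost b \<and> Inv n s') s"
proof -
  have "wp (While b c) (\<lambda>t s'. t \<le> k * (tcost b + T) + tcost b \<and> Inv n s') s"
    if "Inv (n - k) s" "k \<le> n" for k s
    using that
  proof (induction k arbitrary: s)
    case 0
    then show ?case using stop by (auto intro!: wp_While_stop)
  next
    case (Suc k)
    then have body: "tval b s" "wp c (\<lambda>t s'. t \<le> T \<and> Inv (n - k) s') s"
      using step[of "n - Suc k" s] by (auto simp: Suc_diff_Suc)
    show ?case
    proof (rule wp_While_step[OF body(1)], rule wp_mono[OF body(2)])
      fix t s' assume t: "t \<le> T \<and> Inv (n - k) s'"
      have "wp (While b c) (\<lambda>t s'. t \<le> k * (tcost b + T) + tcost b \<and> Inv n s') s'"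
        using Suc t by auto
      then show "wp (While b c) (\<lambda>t' s'. tcost b + t + t' \<le> Suc k * (tcost b + T) + tcost b \<and>
          Inv n s') s'"
        by (rule wp_mono) (use t in auto)
    qed
  qed
  from this[of n s] show ?thesis using assms(1) by simp
qed

text \<open>The arrays a program can modify.\<close>

primrec iwrites :: "com \<Rightarrow> string set" where
  "iwrites Skip = {}"
| "iwrites (ISet a d e) = {a}"
| "iwrites (RSet a d e) = {}"
| "iwrites (Seq c c') = iwrites c \<union> iwrites c'"
| "iwrites (If b c c') = iwrites c \<union> iwrites c'"
| "iwrites (While b c) = iwrites c"

primrec rwrites :: "com \<Rightarrow> string set" where
  "rwrites Skip = {}"
| "rwrites (ISet a d e) = {}"
| "rwrites (RSet a d e) = {a}"
| "rwrites (Seq c c') = rwrites c \<union> rwrites c'"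
| "rwrites (If b c c') = rwrites c \<union> rwrites c'"
| "rwrites (While b c) = rwrites c"

text \<open>The stores differ at most in the number arrays \<open>A\<close> and the real arrays \<open>B\<close>.\<close>

definition agree :: "string set \<Rightarrow> string set \<Rightarrow> store \<Rightarrow> store \<Rightarrow> bool" where
  "agree A B s s' \<longleftrightarrow>
    (\<forall>a. a \<notin> A \<longrightarrow> ints s' a = ints s a) \<and> (\<forall>a. a \<notin> B \<longrightarrow> reals s' a = reals s a)"

lemma agree_mono: "agree A B s s' \<Longrightarrow> A \<subseteq> A' \<Longrightarrow> B \<subseteq> B' \<Longrightarrow> agree A' B' s s'"
  by (auto simp: agree_def)

lemma ints_iupd [simp]: "ints (iupd a j v s) = (ints s)(a := (ints s a)(j := v))"
  and reals_iupd [simp]: "reals (iupd a j v s) = reals s"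
  and ints_rupd [simp]: "ints (rupd a j x s) = ints s"
  and reals_rupd [simp]: "reals (rupd a j x s) = (reals s)(a := (reals s a)(j := x))"
  by (simp_all add: iupd_def rupd_def)

lemma exec_agree: "exec c s t s' \<Longrightarrow> agree (iwrites c) (rwrites c) s s'"
proof (induction rule: exec.induct)
  case (Seq c s t s' c' t' s'')
  then show ?case by (auto simp: agree_def)
next
  case (WhileTrue b s c t s' t' s'')
  then show ?case by (auto simp: agree_def)
qed (auto simp: agree_def)

lemma wp_frame: "wp c Q s \<Longrightarrow> wp c (\<lambda>t s'. Q t s' \<and> agree (iwrites c) (rwrites c) s s') s"
  unfolding wp_def using exec_agree by blast

text \<open>Cell 0 of an array serves as a scalar variable.\<close>

abbreviation ivar :: "string \<Rightarrow> iexp" where "ivar x \<equiv> IGet x (IConst 0)"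
abbreviation iset :: "string \<Rightarrow> iexp \<Rightarrow> com" where "iset x e \<equiv> ISet x (IConst 0) e"
abbreviation rvar :: "string \<Rightarrow> rexp" where "rvar x \<equiv> RGet x (IConst 0)"
abbreviation rset :: "string \<Rightarrow> rexp \<Rightarrow> com" where "rset x e \<equiv> RSet x (IConst 0) e"
abbreviation seq :: "com \<Rightarrow> com \<Rightarrow> com" (infixr ";;" 60) where "c ;; c' \<equiv> Seq c c'"

text \<open>The loop variable runs from \<open>lo\<close> to the value of \<open>e\<close>, both included.\<close>

definition For :: "string \<Rightarrow> nat \<Rightarrow> iexp \<Rightarrow> com \<Rightarrow> com" where
  "For x lo e c = iset x (IConst lo) ;;
     While (ILeq (ivar x) e) (c ;; iset x (IAdd (ivar x) (IConst 1)))"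

lemma writes_For [simp]:
  "iwrites (For x lo e c) = insert x (iwrites c)" "rwrites (For x lo e c) = rwrites c"
  by (auto simp: For_def)

text \<open>Besides the invariant, the body may use that all arrays not written in the loop still have their
  initial contents. The constants in the bound are the costs of the loop control.\<close>

lemma wp_For:
  assumes x: "x \<notin> iwrites c" and range: "lo \<le> Suc hi"
    and hi: "\<And>s'. agree (insert x (iwrites c)) (rwrites c) s s' \<Longrightarrow> ival e s' = hi"
    and base: "\<And>s'. agree {x} {} s s' \<Longrightarrow> Inv lo s'"
    and indep: "\<And>i v s'. Inv i s' \<Longrightarrow> Inv i (iupd x 0 v s')"
    and step: "\<And>i s'. \<lbrakk>lo \<le> i; i \<le> hi; agree (insert x (iwrites c)) (rwrites c) s s';
        ints s' x 0 = i; Inv i s'\<rbrakk> \<Longrightarrow> wp c (\<lambda>t s''. t \<le> T \<and> Inv (Suc i) s'') s'"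
  shows "wp (For x lo e c) (\<lambda>t s'. t \<le> (Suc hi - lo) * (T + icost e + 9) + icost e + 6 \<and>
      Inv (Suc hi) s' \<and> agree (insert x (iwrites c)) (rwrites c) s s') s"
proof -
  let ?A = "agree (insert x (iwrites c)) (rwrites c) s"
  let ?J = "\<lambda>i s'. ?A s' \<and> ints s' x 0 = lo + i \<and> Inv (lo + i) s'"
  let ?n = "Suc hi - lo"
  let ?b = "ILeq (ivar x) e" and ?c = "c ;; iset x (IAdd (ivar x) (IConst 1))"
  have "wp (While ?b ?c) (\<lambda>t s'. t \<le> ?n * (tcost ?b + (T + 6)) + tcost ?b \<and> ?J ?n s')
      (iupd x 0 lo s)"
  proof (rule wp_While)
    have "agree {x} {} s (iupd x 0 lo s)" by (simp add: agree_def)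
    then show "?J 0 (iupd x 0 lo s)"
      using base by (auto elim: agree_mono)
  next
    fix i s' assume i: "i < ?n" and J: "?J i s'"
    have "wp c (\<lambda>t s''. (t \<le> T \<and> Inv (Suc (lo + i)) s'') \<and> agree (iwrites c) (rwrites c) s' s'') s'"
      by (rule wp_frame[OF step]) (use i J in auto)
    then have "wp ?c (\<lambda>t s''. t \<le> T + 6 \<and> ?J (Suc i) s'') s'"
      unfolding wp_Seq
      by (rule wp_mono) (use J x indep in \<open>auto simp: agree_def\<close>)
    then show "tval ?b s' \<and> wp ?c (\<lambda>t s''. t \<le> T + 6 \<and> ?J (Suc i) s'') s'"
      using i J hi[of s'] by auto
  next
    fix s' assume "?J ?n s'"
    then show "\<not> tval ?b s'" using hi[of s'] range by auto
  qed
  then show ?thesis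
    unfolding For_def wp_Seq wp_ISet
    by (auto elim!: wp_mono simp: algebra_simps range)
qed

section \<open>The single-carrier part of the program\<close>

text \<open>Tables indexed by \<open>m\<close> and \<open>k\<close> are stored like the noise powers, in the cells \<open>m * K + k\<close>. Row \<open>m\<close> of
  the tables \<open>D\<close> and \<open>X\<close> will hold the optimal entries of all users for chains of \<open>m\<close> intervals.\<close>

definition row :: "iexp \<Rightarrow> string \<Rightarrow> iexp" where
  "row m k = IAdd (IMul m (ivar ''K'')) (ivar k)"

definition previous :: "string \<Rightarrow> iexp" where
  "previous m = ISub (ivar m) (IConst 1)"

text \<open>Computes \<open>util k t\<close> for the current subcarrier.\<close>

definition rate :: "string \<Rightarrow> rexp \<Rightarrow> rexp" where
  "rate k t = RMul (RGet ''u'' (ivar k)) (RLog2 (RAdd t (RGet ''h'' (ivar k))))"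

text \<open>Copies the data of subcarrier \<open>n\<close> into the arrays \<open>u\<close> and \<open>h\<close> and fills row 0 of the tables.\<close>

definition load_users :: com where
  "load_users = For ''b'' 1 (ivar ''K'') (
     RSet ''u'' (ivar ''b'') (RMul (RGet ''W'' (ivar ''n'')) (RGet ''w'' (ivar ''b''))) ;;
     RSet ''h'' (ivar ''b'') (RGet ''eta'' (row (ivar ''n'') ''b'')) ;;
     RSet ''D'' (ivar ''b'') (RSub (RConst 0) (rate ''b'' (RConst 0))) ;;
     RSet ''X'' (ivar ''b'') (RConst 0))"

text \<open>Offers user \<open>b\<close> to take over from user \<open>e\<close> of the previous row. The variable \<open>t\<close> receives the point
  \<open>switch e b (X e)\<close>.\<close>

definition try_predecessor :: com where
  "try_predecessor =
     If (RLess (RGet ''h'' (ivar ''e'')) (RGet ''h'' (ivar ''b''))) (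
       rset ''t'' (rvar ''Pmax'') ;;
       If (RLess (RGet ''u'' (ivar ''e'')) (RGet ''u'' (ivar ''b''))) (
         rset ''c'' (RDiv
           (RSub (RMul (RGet ''u'' (ivar ''e'')) (RGet ''h'' (ivar ''b'')))
             (RMul (RGet ''u'' (ivar ''b'')) (RGet ''h'' (ivar ''e''))))
           (RSub (RGet ''u'' (ivar ''b'')) (RGet ''u'' (ivar ''e'')))) ;;
         If (RLess (rvar ''c'') (rvar ''t'')) (rset ''t'' (rvar ''c'')) Skip ;;
         If (RLess (rvar ''t'') (RGet ''X'' (row (previous ''m'') ''e'')))
           (rset ''t'' (RGet ''X'' (row (previous ''m'') ''e''))) Skip) Skip ;;
       rset ''v'' (RAdd (RGet ''D'' (row (previous ''m'') ''e''))
         (RSub (rate ''e'' (rvar ''t'')) (rate ''b'' (rvar ''t'')))) ;;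
       If (RLess (RGet ''D'' (row (ivar ''m'') ''b'')) (rvar ''v''))
         (RSet ''D'' (row (ivar ''m'') ''b'') (rvar ''v'') ;;
          RSet ''X'' (row (ivar ''m'') ''b'') (rvar ''t'')) Skip) Skip"

text \<open>The initial candidate is to start at power 0; its value is kept in row 0.\<close>

definition update_user :: com where
  "update_user =
     RSet ''D'' (row (ivar ''m'') ''b'') (RGet ''D'' (ivar ''b'')) ;;
     RSet ''X'' (row (ivar ''m'') ''b'') (RConst 0) ;;
     For ''e'' 1 (ivar ''K'') try_predecessor"

text \<open>Fills the rows up to \<open>M - 1\<close>.\<close>

definition build_entries :: com where
  "build_entries = For ''m'' 1 (ISub (ivar ''M'') (IConst 1)) (For ''b'' 1 (ivar ''K'') update_user)"

text \<open>Computes \<open>G l\<close>, the optimal value of the subcarrier at budget \<open>l \<delta>\<close>, from row \<open>M - 1\<close>: the top user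
  adds the last interval.\<close>

definition evaluate_levels :: com where
  "evaluate_levels = For ''l'' 0 (ivar ''J'') (
     RSet ''G'' (ivar ''l'') (RConst 0) ;;
     For ''b'' 1 (ivar ''K'') (
       If (RLeq (RGet ''X'' (row (previous ''M'') ''b'')) (RGet ''L'' (ivar ''l''))) (
         rset ''v'' (RAdd (RGet ''D'' (row (previous ''M'') ''b''))
           (rate ''b'' (RGet ''L'' (ivar ''l'')))) ;;
         If (RLess (RGet ''G'' (ivar ''l'')) (rvar ''v''))
           (RSet ''G'' (ivar ''l'') (rvar ''v'')) Skip) Skip))"

context single_carrier
begin

lemma entry_candidates_0: "entry_candidates D X b 0 = {(- util b 0, 0)}"
  by (auto simp: entry_candidates_def)

lemma entry_candidates_Suc:
  "entry_candidates D X b (Suc i) = (if h (Suc i) < h b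
     then insert (D (Suc i) + gain (Suc i) b (switch (Suc i) b (X (Suc i))),
            switch (Suc i) b (X (Suc i))) (entry_candidates D X b i)
     else entry_candidates D X b i)"
  by (auto simp: entry_candidates_def atLeastAtMostSuc_conv)

text \<open>The store holds the data of the subcarrier under consideration, and the range of budgets is
  bounded by the total budget.\<close>

definition loaded :: "store \<Rightarrow> bool" where
  "loaded s \<longleftrightarrow> ints s ''K'' 0 = K \<and> reals s ''Pmax'' 0 = B \<and>
     (\<forall>k\<in>{1..K}. reals s ''u'' k = u k \<and> reals s ''h'' k = h k)"

text \<open>The tables \<open>D\<close> and \<open>X\<close> differ at most in the cells \<open>A\<close>.\<close>

definition same_tables :: "nat set \<Rightarrow> store \<Rightarrow> store \<Rightarrow> bool" where
  "same_tables A s s' \<longleftrightarrow> (\<forall>j. j \<notin> A \<longrightarrow>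
     reals s' ''D'' j = reals s ''D'' j \<and> reals s' ''X'' j = reals s ''X'' j)"

text \<open>The numerical cost bounds here and below are rounded up.\<close>

lemma wp_try_predecessor:
  assumes s: "loaded s" "ints s ''m'' 0 = Suc m" "ints s ''b'' 0 = b" "ints s ''e'' 0 = Suc i"
    and i: "Suc i \<in> {1..K}" and b: "b \<in> {1..K}"
    and best: "best_of (entry_candidates (\<lambda>e. reals s ''D'' (m * K + e))
        (\<lambda>e. reals s ''X'' (m * K + e)) b i)
      (reals s ''D'' (Suc m * K + b), reals s ''X'' (Suc m * K + b))"
  shows "wp try_predecessor (\<lambda>t s'. t \<le> 200 \<and> same_tables {Suc m * K + b} s s' \<and>
      best_of (entry_candidates (\<lambda>e. reals s ''D'' (m * K + e))
        (\<lambda>e. reals s ''X'' (m * K + e)) b (Suc i))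
      (reals s' ''D'' (Suc m * K + b), reals s' ''X'' (Suc m * K + b))) s"
proof -
  let ?D = "\<lambda>e. reals s ''D'' (m * K + e)" and ?X = "\<lambda>e. reals s ''X'' (m * K + e)"
  have u: "reals s ''u'' (Suc i) = u (Suc i)" "reals s ''h'' (Suc i) = h (Suc i)"
    "reals s ''u'' b = u b" "reals s ''h'' b = h b"
    and K: "ints s ''K'' 0 = K" "reals s ''Pmax'' 0 = B"
    using s(1) i b by (auto simp: loaded_def)
  define c where "c = entry_candidates ?D ?X b i"
  define d where "d = ?D (Suc i)"
  define x where "x = ?X (Suc i)"
  define d0 where "d0 = reals s ''D'' (Suc m * K + b)"
  define x0 where "x0 = reals s ''X'' (Suc m * K + b)"
  have cell: "reals s ''D'' (m * K + Suc i) = d" "reals s ''X'' (m * K + Suc i) = x"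
    "reals s ''D'' (K + m * K + b) = d0" "reals s ''X'' (K + m * K + b) = x0"
    "reals s ''D'' (Suc (m * K + i)) = d" "reals s ''X'' (Suc (m * K + i)) = x"
    by (simp_all add: d_def x_def d0_def x0_def)
  have best': "best_of c (d0, x0)"
    using best by (simp add: c_def d0_def x0_def)
  have cands: "entry_candidates ?D ?X b (Suc i) = (if h (Suc i) < h b
     then insert (d + gain (Suc i) b (switch (Suc i) b x), switch (Suc i) b x) c else c)"
    by (simp add: entry_candidates_Suc c_def d_def x_def)
  have sw: "switch (Suc i) b x = (if u (Suc i) < u b then
      let c = (u (Suc i) * h b - u b * h (Suc i)) / (u b - u (Suc i));
          t = (if c < B then c else B) in if t < x then x else t
    else B)"
    by (auto simp: switch_def peak_def max_def min_def Let_def)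
  show ?thesis
    unfolding cands try_predecessor_def row_def previous_def rate_def
    using best_of_insert[OF best', of "d + gain (Suc i) b (switch (Suc i) b x)" "switch (Suc i) b x"]
      best'
    by (auto simp: s u K cell same_tables_def sw gain_def util_def Let_def not_less)
qed

end

lemma writes_programs [simp]:
  "iwrites try_predecessor = {}" "rwrites try_predecessor = {''t'', ''c'', ''v'', ''D'', ''X''}"
  "iwrites update_user = {''e''}" "rwrites update_user = {''t'', ''c'', ''v'', ''D'', ''X''}"
  "iwrites build_entries = {''m'', ''b'', ''e''}"
  "rwrites build_entries = {''t'', ''c'', ''v'', ''D'', ''X''}"
  "iwrites load_users = {''b''}" "rwrites load_users = {''u'', ''h'', ''D'', ''X''}"
  "iwrites evaluate_levels = {''l'', ''b''}" "rwrites evaluate_levels = {''G'', ''v''}"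
  by (auto simp: try_predecessor_def update_user_def build_entries_def load_users_def
      evaluate_levels_def)

context single_carrier
begin

lemma entry_candidates_cong:
  assumes "\<And>e. e \<in> {1..i} \<Longrightarrow> D e = D' e" "\<And>e. e \<in> {1..i} \<Longrightarrow> X e = X' e"
  shows "entry_candidates D X b i = entry_candidates D' X' b i"
proof -
  have "{(D e + gain e b (switch e b (X e)), switch e b (X e)) | e. e \<in> {1..i} \<and> h e < h b} =
    {(D' e + gain e b (switch e b (X' e)), switch e b (X' e)) | e. e \<in> {1..i} \<and> h e < h b}"
    using assms by (intro Collect_cong) (metis)
  then show ?thesis by (simp add: entry_candidates_def)
qed

lemma loaded_agree:
  assumes "loaded s" "agree A C s s'" "''K'' \<notin> A" "''Pmax'' \<notin> C" "''u'' \<notin> C" "''h'' \<notin> C"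
  shows "loaded s'"
  using assms by (simp add: loaded_def agree_def)

lemma wp_update_user:
  assumes s: "loaded s" "ints s ''m'' 0 = Suc m" "ints s ''b'' 0 = b"
    and b: "b \<in> {1..K}" and first: "reals s ''D'' b = - util b 0"
  shows "wp update_user (\<lambda>t s'. t \<le> 300 * K \<and> same_tables {Suc m * K + b} s s' \<and>
      best_of (entry_candidates (\<lambda>e. reals s ''D'' (m * K + e))
        (\<lambda>e. reals s ''X'' (m * K + e)) b K)
      (reals s' ''D'' (Suc m * K + b), reals s' ''X'' (Suc m * K + b))) s"
proof -
  let ?D = "\<lambda>e. reals s ''D'' (m * K + e)" and ?X = "\<lambda>e. reals s ''X'' (m * K + e)"
  let ?c = "Suc m * K + b"
  define s1 where "s1 = rupd ''X'' ?c 0 (rupd ''D'' ?c (- util b 0) s)"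
  define Inv where "Inv = (\<lambda>i (s' :: store). same_tables {?c} s s' \<and>
    best_of (entry_candidates ?D ?X b (i - 1)) (reals s' ''D'' ?c, reals s' ''X'' ?c))"
  have other: "m * K + e \<noteq> ?c" if "e \<in> {1..K}" for e using that b by auto
  have K: "ints s ''K'' 0 = K" using s(1) by (simp add: loaded_def)
  have loaded1: "loaded s1" using s(1) by (simp add: loaded_def s1_def)
  have "wp (For ''e'' 1 (ivar ''K'') try_predecessor) (\<lambda>t s'.
      t \<le> (Suc K - 1) * (200 + icost (ivar ''K'') + 9) + icost (ivar ''K'') + 6 \<and>
      Inv (Suc K) s' \<and>
      agree (insert ''e'' (iwrites try_predecessor)) (rwrites try_predecessor) s1 s') s1"
  proof (rule wp_For)
    fix s' assume "agree (insert ''e'' (iwrites try_predecessor)) (rwrites try_predecessor) s1 s'"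
    then show "ival (ivar ''K'') s' = K" using K by (simp add: agree_def s1_def)
  next
    fix s' assume "agree {''e''} {} s1 s'"
    then show "Inv 1 s'"
      by (auto simp: Inv_def s1_def agree_def same_tables_def entry_candidates_0 best_of_def)
  next
    fix i s'
    assume i: "1 \<le> i" "i \<le> K" and e: "ints s' ''e'' 0 = i" and inv: "Inv i s'"
      and ag: "agree (insert ''e'' (iwrites try_predecessor)) (rwrites try_predecessor) s1 s'"
    obtain j where j: "i = Suc j" using i by (cases i) auto
    have loaded: "loaded s'" using loaded_agree[OF loaded1 ag] by simp
    have mb: "ints s' ''m'' 0 = Suc m" "ints s' ''b'' 0 = b"
      using ag s by (simp_all add: agree_def s1_def)
    have same: "reals s' ''D'' (m * K + e) = ?D e" "reals s' ''X'' (m * K + e) = ?X e"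
      if "e \<in> {1..K}" for e
      using inv other[OF that] by (auto simp: Inv_def same_tables_def)
    have cand: "entry_candidates (\<lambda>e. reals s' ''D'' (m * K + e))
        (\<lambda>e. reals s' ''X'' (m * K + e)) b i' = entry_candidates ?D ?X b i'" if "i' \<le> K" for i'
      by (rule entry_candidates_cong) (use same that in auto)
    have "wp try_predecessor (\<lambda>t s''. t \<le> 200 \<and> same_tables {?c} s' s'' \<and>
      best_of (entry_candidates (\<lambda>e. reals s' ''D'' (m * K + e))
        (\<lambda>e. reals s' ''X'' (m * K + e)) b (Suc j))
      (reals s'' ''D'' ?c, reals s'' ''X'' ?c)) s'"
      by (rule wp_try_predecessor)
        (use loaded mb e j i b inv cand[of j] in \<open>auto simp: Inv_def\<close>)
    then show "wp try_predecessor (\<lambda>t s''. t \<le> 200 \<and> Inv (Suc i) s'') s'"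
      by (rule wp_mono) (use inv cand[of i] i j in \<open>auto simp: Inv_def same_tables_def\<close>)
  next
    fix i v s' assume "Inv i s'" then show "Inv i (iupd ''e'' 0 v s')"
      by (simp add: Inv_def same_tables_def)
  qed (use b in auto)
  then show ?thesis
    unfolding update_user_def wp_Seq wp_RSet
    using b by (auto elim!: wp_mono simp: row_def K s first s1_def Inv_def)
qed

text \<open>Row \<open>m\<close> of the tables is correct for user \<open>k\<close>.\<close>

definition entries :: "nat \<Rightarrow> nat \<Rightarrow> store \<Rightarrow> bool" where
  "entries m k s \<longleftrightarrow> optimal_entry m k (reals s ''D'' (m * K + k)) (reals s ''X'' (m * K + k))"

lemma wp_layer:
  assumes s: "loaded s" "ints s ''m'' 0 = Suc m" and K: "1 \<le> K"
    and first: "\<And>k. k \<in> {1..K} \<Longrightarrow> reals s ''D'' k = - util k 0"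
    and entries: "\<And>k. k \<in> {1..K} \<Longrightarrow> entries m k s"
  shows "wp (For ''b'' 1 (ivar ''K'') update_user) (\<lambda>t s'. t \<le> 400 * K * K \<and>
      same_tables {Suc m * K<..} s s' \<and> (\<forall>k\<in>{1..K}. entries (Suc m) k s')) s"
proof -
  define Inv where "Inv = (\<lambda>i (s' :: store). same_tables {Suc m * K<..} s s' \<and>
    (\<forall>k\<in>{1..<i}. entries (Suc m) k s'))"
  have "wp (For ''b'' 1 (ivar ''K'') update_user) (\<lambda>t s'.
      t \<le> (Suc K - 1) * (300 * K + icost (ivar ''K'') + 9) + icost (ivar ''K'') + 6 \<and>
      Inv (Suc K) s' \<and>
      agree (insert ''b'' (iwrites update_user)) (rwrites update_user) s s') s"
  proof (rule wp_For)
    fix s' assume "agree (insert ''b'' (iwrites update_user)) (rwrites update_user) s s'"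
    then show "ival (ivar ''K'') s' = K" using s by (simp add: agree_def loaded_def)
  next
    fix s' assume "agree {''b''} {} s s'"
    then show "Inv 1 s'" by (simp add: Inv_def agree_def same_tables_def)
  next
    fix i s'
    assume i: "1 \<le> i" "i \<le> K" and b: "ints s' ''b'' 0 = i" and inv: "Inv i s'"
      and ag: "agree (insert ''b'' (iwrites update_user)) (rwrites update_user) s s'"
    have loaded: "loaded s'" using loaded_agree[OF s(1) ag] by simp
    have m: "ints s' ''m'' 0 = Suc m" using ag s by (simp add: agree_def)
    have same: "reals s' ''D'' j = reals s ''D'' j" "reals s' ''X'' j = reals s ''X'' j"
      if "j \<le> Suc m * K" for j
      using inv that by (auto simp: Inv_def same_tables_def)
    have opt: "optimal_entry m e (reals s' ''D'' (m * K + e)) (reals s' ''X'' (m * K + e))"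
      if "e \<in> {1..K}" for e
      using entries[OF that] same[of "m * K + e"] that by (simp add: entries_def)
    have first': "reals s' ''D'' i = - util i 0"
      using same(1)[of i] first[of i] i by simp
    have "wp update_user (\<lambda>t s''. t \<le> 300 * K \<and> same_tables {Suc m * K + i} s' s'' \<and>
      best_of (entry_candidates (\<lambda>e. reals s' ''D'' (m * K + e))
        (\<lambda>e. reals s' ''X'' (m * K + e)) i K)
      (reals s'' ''D'' (Suc m * K + i), reals s'' ''X'' (Suc m * K + i))) s'"
      by (rule wp_update_user[OF loaded m b _ first']) (use i in auto)
    then show "wp update_user (\<lambda>t s''. t \<le> 300 * K \<and> Inv (Suc i) s'') s'"
    proof (rule wp_mono)
      fix t s''
      assume post: "t \<le> 300 * K \<and> same_tables {Suc m * K + i} s' s'' \<and>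
        best_of (entry_candidates (\<lambda>e. reals s' ''D'' (m * K + e))
          (\<lambda>e. reals s' ''X'' (m * K + e)) i K)
        (reals s'' ''D'' (Suc m * K + i), reals s'' ''X'' (Suc m * K + i))"
      then have "entries (Suc m) i s''"
        unfolding entries_def using i by (intro optimal_entry_Suc[OF opt]) auto
      moreover have "entries (Suc m) k s''" if "k \<in> {1..<i}" for k
        using inv post that by (simp add: Inv_def entries_def same_tables_def)
      moreover have "same_tables {Suc m * K<..} s s''"
        using inv post i by (simp add: Inv_def same_tables_def)
      ultimately show "t \<le> 300 * K \<and> Inv (Suc i) s''"
        using post i by (auto simp: Inv_def less_Suc_eq)
    qed
  next
    fix i v s' assume "Inv i s'" then show "Inv i (iupd ''b'' 0 v s')"
      by (simp add: Inv_def same_tables_def entries_def)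
  qed auto
  then show ?thesis
  proof (rule wp_mono)
    fix t s'
    assume post: "t \<le> (Suc K - 1) * (300 * K + icost (ivar ''K'') + 9) + icost (ivar ''K'') + 6 \<and>
      Inv (Suc K) s' \<and> agree (insert ''b'' (iwrites update_user)) (rwrites update_user) s s'"
    have "t \<le> 300 * (K * K) + 11 * K + 8" using post by (simp add: algebra_simps)
    moreover have "1 \<le> K * K" "K \<le> K * K" using K by auto
    ultimately have "t \<le> 400 * K * K" by linarith
    then show "t \<le> 400 * K * K \<and> same_tables {Suc m * K<..} s s' \<and>
        (\<forall>k\<in>{1..K}. entries (Suc m) k s')"
      using post by (auto simp: Inv_def)
  qed
qed

lemma wp_build_entries:
  assumes s: "loaded s" "ints s ''M'' 0 = M" and K: "1 \<le> K" and M: "1 \<le> M"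
    and first: "\<And>k. k \<in> {1..K} \<Longrightarrow> reals s ''D'' k = - util k 0 \<and> reals s ''X'' k = 0"
  shows "wp build_entries (\<lambda>t s'. t \<le> 500 * M * (K * K) \<and>
      (\<forall>k\<in>{1..K}. entries (M - 1) k s')) s"
proof -
  let ?c = "For ''b'' 1 (ivar ''K'') update_user" and ?e = "ISub (ivar ''M'') (IConst 1)"
  define Inv where "Inv = (\<lambda>i (s' :: store). (\<forall>k\<in>{1..K}. reals s' ''D'' k = - util k 0) \<and>
    (\<forall>k\<in>{1..K}. entries (i - 1) k s'))"
  have "wp (For ''m'' 1 ?e ?c) (\<lambda>t s'.
      t \<le> (Suc (M - 1) - 1) * (400 * K * K + icost ?e + 9) + icost ?e + 6 \<and>
      Inv (Suc (M - 1)) s' \<and> agree (insert ''m'' (iwrites ?c)) (rwrites ?c) s s') s"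
  proof (rule wp_For)
    fix s' assume "agree (insert ''m'' (iwrites ?c)) (rwrites ?c) s s'"
    then show "ival ?e s' = M - 1" using s by (simp add: agree_def)
  next
    fix s' assume "agree {''m''} {} s s'"
    then show "Inv 1 s'" using first optimal_entry_0 by (simp add: Inv_def agree_def entries_def)
  next
    fix i s'
    assume i: "1 \<le> i" "i \<le> M - 1" and m: "ints s' ''m'' 0 = i" and inv: "Inv i s'"
      and ag: "agree (insert ''m'' (iwrites ?c)) (rwrites ?c) s s'"
    obtain j where j: "i = Suc j" using i by (cases i) auto
    have loaded: "loaded s'" using loaded_agree[OF s(1) ag] by simp
    have "wp ?c (\<lambda>t s''. t \<le> 400 * K * K \<and> same_tables {Suc j * K<..} s' s'' \<and>
        (\<forall>k\<in>{1..K}. entries (Suc j) k s'')) s'"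
      by (rule wp_layer[OF loaded _ K]) (use m j inv in \<open>auto simp: Inv_def\<close>)
    then show "wp ?c (\<lambda>t s''. t \<le> 400 * K * K \<and> Inv (Suc i) s'') s'"
      by (rule wp_mono) (use inv j in \<open>auto simp: Inv_def same_tables_def\<close>)
  next
    fix i v s' assume "Inv i s'" then show "Inv i (iupd ''m'' 0 v s')"
      by (simp add: Inv_def entries_def)
  qed auto
  then show ?thesis
    unfolding build_entries_def
  proof (rule wp_mono)
    fix t s'
    assume post: "t \<le> (Suc (M - 1) - 1) * (400 * K * K + icost ?e + 9) + icost ?e + 6 \<and>
      Inv (Suc (M - 1)) s' \<and> agree (insert ''m'' (iwrites ?c)) (rwrites ?c) s s'"
    obtain m where m: "M = Suc m" using M by (cases M) auto
    have "t \<le> 400 * (m * (K * K)) + 13 * m + 10" using post m by (simp add: algebra_simps)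
    moreover have "1 \<le> K * K" "m \<le> m * (K * K)" using K by auto
    ultimately have "t \<le> 500 * (m * (K * K)) + 500 * (K * K)" by linarith
    then have "t \<le> 500 * M * (K * K)" using m by (simp add: algebra_simps)
    then show "t \<le> 500 * M * (K * K) \<and> (\<forall>k\<in>{1..K}. entries (M - 1) k s')"
      using post by (auto simp: Inv_def)
  qed
qed

lemma wp_load_users:
  assumes s: "ints s ''K'' 0 = K" "ints s ''n'' 0 = n" "reals s ''Pmax'' 0 = B" and K: "1 \<le> K"
    and u: "\<And>k. k \<in> {1..K} \<Longrightarrow> reals s ''W'' n * reals s ''w'' k = u k"
    and h: "\<And>k. k \<in> {1..K} \<Longrightarrow> reals s ''eta'' (n * K + k) = h k"
  shows "wp load_users (\<lambda>t s'. t \<le> 100 * K \<and> loaded s' \<and>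
      (\<forall>k\<in>{1..K}. reals s' ''D'' k = - util k 0 \<and> reals s' ''X'' k = 0)) s"
proof -
  define Inv where "Inv = (\<lambda>i (s' :: store). \<forall>k\<in>{1..<i}. reals s' ''u'' k = u k \<and> reals s' ''h'' k = h k \<and>
    reals s' ''D'' k = - util k 0 \<and> reals s' ''X'' k = 0)"
  have "wp load_users (\<lambda>t s'.
      t \<le> (Suc K - 1) * (60 + icost (ivar ''K'') + 9) + icost (ivar ''K'') + 6 \<and>
      Inv (Suc K) s' \<and> agree {''b''} {''u'', ''h'', ''D'', ''X''} s s') s"
    unfolding load_users_def
  proof (rule wp_mono, rule wp_For[where hi = K and T = 60 and Inv = Inv])
    fix i s' assume i: "1 \<le> i" "i \<le> K" and b: "ints s' ''b'' 0 = i" and inv: "Inv i s'"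
      and ag: "agree (insert ''b'' (iwrites (
         RSet ''u'' (ivar ''b'') (RMul (RGet ''W'' (ivar ''n'')) (RGet ''w'' (ivar ''b''))) ;;
         RSet ''h'' (ivar ''b'') (RGet ''eta'' (row (ivar ''n'') ''b'')) ;;
         RSet ''D'' (ivar ''b'') (RSub (RConst 0) (rate ''b'' (RConst 0))) ;;
         RSet ''X'' (ivar ''b'') (RConst 0)))) (rwrites (
         RSet ''u'' (ivar ''b'') (RMul (RGet ''W'' (ivar ''n'')) (RGet ''w'' (ivar ''b''))) ;;
         RSet ''h'' (ivar ''b'') (RGet ''eta'' (row (ivar ''n'') ''b'')) ;;
         RSet ''D'' (ivar ''b'') (RSub (RConst 0) (rate ''b'' (RConst 0))) ;;
         RSet ''X'' (ivar ''b'') (RConst 0))) s s'"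
    have "ints s' ''K'' 0 = K" "ints s' ''n'' 0 = n" "reals s' ''W'' = reals s ''W''"
      "reals s' ''w'' = reals s ''w''" "reals s' ''eta'' = reals s ''eta''"
      using ag s by (simp_all add: agree_def)
    then show "wp (
         RSet ''u'' (ivar ''b'') (RMul (RGet ''W'' (ivar ''n'')) (RGet ''w'' (ivar ''b''))) ;;
         RSet ''h'' (ivar ''b'') (RGet ''eta'' (row (ivar ''n'') ''b'')) ;;
         RSet ''D'' (ivar ''b'') (RSub (RConst 0) (rate ''b'' (RConst 0))) ;;
         RSet ''X'' (ivar ''b'') (RConst 0)) (\<lambda>t s''. t \<le> 60 \<and> Inv (Suc i) s'') s'"
      using inv i b u[of i] h[of i]
      by (auto simp: Inv_def row_def rate_def util_def less_Suc_eq)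
  qed (use s in \<open>auto simp: Inv_def agree_def\<close>)
  then show ?thesis
    by (rule wp_mono) (use s K in \<open>auto simp: Inv_def loaded_def agree_def\<close>)
qed

lemma value_candidates_0: "value_candidates D X p 0 = {0}"
  by (auto simp: value_candidates_def)

lemma value_candidates_Suc:
  "value_candidates D X p (Suc i) = (if X (Suc i) \<le> p
     then insert (D (Suc i) + util (Suc i) p) (value_candidates D X p i)
     else value_candidates D X p i)"
  by (auto simp: value_candidates_def atLeastAtMostSuc_conv)

lemma wp_evaluate_levels:
  assumes s: "loaded s" "ints s ''M'' 0 = M" "ints s ''J'' 0 = J" and K: "1 \<le> K"
  defines "D \<equiv> \<lambda>k. reals s ''D'' ((M - 1) * K + k)" and "X \<equiv> \<lambda>k. reals s ''X'' ((M - 1) * K + k)"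
  shows "wp evaluate_levels (\<lambda>t s'. t \<le> 200 * (J + 1) * K \<and>
      (\<forall>l\<le>J. max_of (value_candidates D X (reals s ''L'' l) K) (reals s' ''G'' l))) s"
proof -
  let ?body = "If (RLeq (RGet ''X'' (row (previous ''M'') ''b'')) (RGet ''L'' (ivar ''l''))) (
         rset ''v'' (RAdd (RGet ''D'' (row (previous ''M'') ''b''))
           (rate ''b'' (RGet ''L'' (ivar ''l'')))) ;;
         If (RLess (RGet ''G'' (ivar ''l'')) (rvar ''v''))
           (RSet ''G'' (ivar ''l'') (rvar ''v'')) Skip) Skip"
  let ?c = "RSet ''G'' (ivar ''l'') (RConst 0) ;; For ''b'' 1 (ivar ''K'') ?body"
  define L where "L = reals s ''L''"
  define Inv where "Inv = (\<lambda>i (s' :: store). \<forall>l<i. max_of (value_candidates D X (L l) K) (reals s' ''G'' l))"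
  define good where "good s' \<longleftrightarrow> ints s' ''K'' 0 = K \<and> ints s' ''M'' 0 = M \<and> reals s' ''L'' = L \<and>
    (\<forall>k\<in>{1..K}. reals s' ''u'' k = u k \<and> reals s' ''h'' k = h k) \<and>
    reals s' ''D'' = reals s ''D'' \<and> reals s' ''X'' = reals s ''X''" for s' :: store
  have inner: "wp ?c (\<lambda>t s''. t \<le> 120 * K \<and> Inv (Suc l) s'') s'"
    if good: "good s'" and l: "ints s' ''l'' 0 = l" and inv: "Inv l s'" for l s'
  proof -
    define Inv' where "Inv' = (\<lambda>i (s' :: store). Inv l s' \<and>
      max_of (value_candidates D X (L l) (i - 1)) (reals s' ''G'' l))"
    define s1 where "s1 = rupd ''G'' l 0 s'"
    have "wp (For ''b'' 1 (ivar ''K'') ?body) (\<lambda>t s'.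
        t \<le> (Suc K - 1) * (80 + icost (ivar ''K'') + 9) + icost (ivar ''K'') + 6 \<and>
        Inv' (Suc K) s' \<and> agree (insert ''b'' (iwrites ?body)) (rwrites ?body) s1 s') s1"
    proof (rule wp_For)
      fix s2 assume "agree (insert ''b'' (iwrites ?body)) (rwrites ?body) s1 s2"
      then show "ival (ivar ''K'') s2 = K" using good by (simp add: agree_def s1_def good_def)
    next
      fix s2 assume "agree {''b''} {} s1 s2"
      then show "Inv' 1 s2"
        using inv by (simp add: agree_def s1_def Inv'_def Inv_def value_candidates_0 max_of_def)
    next
      fix i s2
      assume i: "1 \<le> i" "i \<le> K" and b: "ints s2 ''b'' 0 = i" and inv': "Inv' i s2"
        and ag: "agree (insert ''b'' (iwrites ?body)) (rwrites ?body) s1 s2"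
      obtain j where j: "i = Suc j" using i by (cases i) auto
      have facts: "ints s2 ''K'' 0 = K" "ints s2 ''M'' 0 = M" "ints s2 ''l'' 0 = l"
        "reals s2 ''L'' = L" "reals s2 ''u'' (Suc j) = u (Suc j)" "reals s2 ''h'' (Suc j) = h (Suc j)"
        using ag good l i j by (simp_all add: agree_def s1_def good_def)
      have "reals s2 ''D'' = reals s ''D''" "reals s2 ''X'' = reals s ''X''"
        using ag good by (simp_all add: agree_def s1_def good_def)
      then have cell: "reals s2 ''D'' ((M - Suc 0) * K + Suc j) = D (Suc j)"
        "reals s2 ''X'' ((M - Suc 0) * K + Suc j) = X (Suc j)"
        by (simp_all add: D_def X_def)
      show "wp ?body (\<lambda>t s''. t \<le> 80 \<and> Inv' (Suc i) s'') s2"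
        using inv' b j unfolding row_def previous_def rate_def
        by (auto simp: facts cell[simplified] Inv'_def Inv_def max_of_def value_candidates_Suc util_def)
    next
      fix i v s2 assume "Inv' i s2" then show "Inv' i (iupd ''b'' 0 v s2)"
        by (simp add: Inv'_def Inv_def)
    qed auto
    then show ?thesis
      unfolding wp_Seq wp_RSet
      using K by (auto elim!: wp_mono simp: l s1_def Inv'_def Inv_def less_Suc_eq)
  qed
  have "wp evaluate_levels (\<lambda>t s'.
      t \<le> (Suc J - 0) * (120 * K + icost (ivar ''J'') + 9) + icost (ivar ''J'') + 6 \<and>
      Inv (Suc J) s' \<and> agree (insert ''l'' (iwrites ?c)) (rwrites ?c) s s') s"
    unfolding evaluate_levels_def
  proof (rule wp_For)
    fix i s' assume i: "ints s' ''l'' 0 = i" "Inv i s'"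
      and ag: "agree (insert ''l'' (iwrites ?c)) (rwrites ?c) s s'"
    have "good s'" using ag s by (simp add: agree_def good_def loaded_def L_def)
    then show "wp ?c (\<lambda>t s''. t \<le> 120 * K \<and> Inv (Suc i) s'') s'" using i by (rule inner)
  qed (use s in \<open>auto simp: Inv_def agree_def\<close>)
  then show ?thesis
  proof (rule wp_mono)
    fix t s'
    assume post: "t \<le> (Suc J - 0) * (120 * K + icost (ivar ''J'') + 9) + icost (ivar ''J'') + 6 \<and>
      Inv (Suc J) s' \<and> agree (insert ''l'' (iwrites ?c)) (rwrites ?c) s s'"
    have "t \<le> 120 * (J * K) + 120 * K + 11 * J + 19" using post by (simp add: algebra_simps)
    moreover have "J \<le> J * K" using K by simp
    ultimately have "t \<le> 200 * (J * K) + 200 * K" using K by linarith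
    then have "t \<le> 200 * (J + 1) * K" by (simp add: algebra_simps)
    then show "t \<le> 200 * (J + 1) * K \<and>
        (\<forall>l\<le>J. max_of (value_candidates D X (reals s ''L'' l) K) (reals s' ''G'' l))"
      using post by (auto simp: Inv_def L_def)
  qed
qed

end

section \<open>The budget part of the program\<close>

text \<open>There is no conversion from reals to numbers, so \<open>J\<close> is found by counting. The array \<open>L\<close> holds the
  multiples of \<open>\<delta>\<close>.\<close>

definition compute_levels :: com where
  "compute_levels =
     iset ''J'' (IConst 0) ;; RSet ''L'' (IConst 0) (RConst 0) ;;
     While (RLeq (RAdd (RGet ''L'' (ivar ''J'')) (rvar ''delta'')) (rvar ''Pmax'')) (
       RSet ''L'' (IAdd (ivar ''J'') (IConst 1)) (RAdd (RGet ''L'' (ivar ''J'')) (rvar ''delta'')) ;;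
       iset ''J'' (IAdd (ivar ''J'') (IConst 1)))"

text \<open>The knapsack tables have rows of length \<open>J + 1\<close>.\<close>

definition cell :: "iexp \<Rightarrow> iexp \<Rightarrow> iexp" where
  "cell n l = IAdd (IMul n (IAdd (ivar ''J'') (IConst 1))) l"

definition cell_pos :: "nat \<Rightarrow> nat \<Rightarrow> nat \<Rightarrow> nat" where
  "cell_pos J n l = n * Suc J + l"

definition clear_table :: com where
  "clear_table = For ''l'' 0 (ivar ''J'') (RSet ''V'' (ivar ''l'') (RConst 0))"

text \<open>Row \<open>n\<close> of the value table \<open>V\<close> and of the table \<open>S\<close> of choices, from row \<open>n - 1\<close> and the values \<open>G\<close> of
  subcarrier \<open>n\<close>. Giving 0 units is always allowed and serves as the initial candidate.\<close>

definition extend_table :: com where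
  "extend_table = For ''l'' 0 (ivar ''J'') (
     RSet ''V'' (cell (ivar ''n'') (ivar ''l''))
       (RAdd (RGet ''V'' (cell (previous ''n'') (ivar ''l''))) (RGet ''G'' (IConst 0))) ;;
     ISet ''S'' (cell (ivar ''n'') (ivar ''l'')) (IConst 0) ;;
     For ''q'' 1 (ivar ''l'') (
       If (RLeq (RGet ''L'' (ivar ''q'')) (RGet ''Plim'' (ivar ''n''))) (
         rset ''v'' (RAdd (RGet ''V'' (cell (previous ''n'') (ISub (ivar ''l'') (ivar ''q''))))
           (RGet ''G'' (ivar ''q''))) ;;
         If (RLess (RGet ''V'' (cell (ivar ''n'') (ivar ''l''))) (rvar ''v''))
           (RSet ''V'' (cell (ivar ''n'') (ivar ''l'')) (rvar ''v'') ;;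
            ISet ''S'' (cell (ivar ''n'') (ivar ''l'')) (ivar ''q'')) Skip) Skip))"

definition treat_subcarriers :: com where
  "treat_subcarriers = For ''n'' 1 (ivar ''N'')
     (load_users ;; build_entries ;; evaluate_levels ;; extend_table)"

text \<open>Serves the subcarriers \<open>N, \<dots>, 1\<close>; \<open>r\<close> counts the units left.\<close>

definition backtrack :: com where
  "backtrack = iset ''r'' (ivar ''J'') ;; For ''j'' 1 (ivar ''N'') (
     iset ''n'' (ISub (IAdd (ivar ''N'') (IConst 1)) (ivar ''j'')) ;;
     iset ''q'' (IGet ''S'' (cell (ivar ''n'') (ivar ''r''))) ;;
     RSet ''P'' (ivar ''n'') (RGet ''L'' (ivar ''q'')) ;;
     iset ''r'' (ISub (ivar ''r'') (ivar ''q'')))"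

definition opt_jspa :: com where
  "opt_jspa = compute_levels ;; clear_table ;; treat_subcarriers ;; backtrack"

lemma writes_knapsack [simp]:
  "iwrites compute_levels = {''J''}" "rwrites compute_levels = {''L''}"
  "iwrites clear_table = {''l''}" "rwrites clear_table = {''V''}"
  "iwrites extend_table = {''l'', ''S'', ''q''}" "rwrites extend_table = {''V'', ''v''}"
  "iwrites treat_subcarriers = {''n'', ''b'', ''m'', ''e'', ''l'', ''S'', ''q''}"
  "rwrites treat_subcarriers = {''u'', ''h'', ''D'', ''X'', ''t'', ''c'', ''v'', ''G'', ''V''}"
  by (auto simp: compute_levels_def clear_table_def extend_table_def treat_subcarriers_def)

lemma ival_cell [simp]: "ival (cell a b) s = cell_pos (ints s ''J'' 0) (ival a s) (ival b s)"
  by (simp add: cell_def cell_pos_def)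

lemma icost_cell [simp]: "icost (cell a b) = 6 + icost a + icost b"
  by (simp add: cell_def)

lemma cell_pos_less: "n < n' \<Longrightarrow> l \<le> J \<Longrightarrow> cell_pos J n l < cell_pos J n' l'"
proof -
  assume "n < n'" "l \<le> J"
  then have "Suc n * Suc J \<le> n' * Suc J" by (intro mult_le_mono1) simp
  then show ?thesis using \<open>l \<le> J\<close> unfolding cell_pos_def by simp
qed

lemma wp_compute_levels:
  assumes I: "valid_jspa I" "0 < \<delta>" and s: "holds_input I \<delta> s"
  shows "wp compute_levels (\<lambda>t s'. t \<le> 60 * (num_levels I \<delta> + 1) \<and>
    ints s' ''J'' 0 = num_levels I \<delta> \<and> (\<forall>l\<le>num_levels I \<delta>. reals s' ''L'' l = real l * \<delta>)) s"
proof -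
  let ?J = "num_levels I \<delta>"
  let ?b = "RLeq (RAdd (RGet ''L'' (ivar ''J'')) (rvar ''delta'')) (rvar ''Pmax'')"
  let ?c = "RSet ''L'' (IAdd (ivar ''J'') (IConst 1)) (RAdd (RGet ''L'' (ivar ''J'')) (rvar ''delta'')) ;;
       iset ''J'' (IAdd (ivar ''J'') (IConst 1))"
  let ?Inv = "\<lambda>i (s' :: store). ints s' ''J'' 0 = i \<and> (\<forall>l\<le>i. reals s' ''L'' l = real l * \<delta>) \<and>
    reals s' ''delta'' 0 = \<delta> \<and> reals s' ''Pmax'' 0 = power_budget I"
  let ?s = "rupd ''L'' 0 0 (iupd ''J'' 0 0 s)"
  have "wp (While ?b ?c) (\<lambda>t s'. t \<le> ?J * (tcost ?b + 20) + tcost ?b \<and> ?Inv ?J s') ?s"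
  proof (rule wp_While)
    show "?Inv 0 ?s" using s by (simp add: holds_input_def)
  next
    fix i s' assume i: "i < ?J" and inv: "?Inv i s'"
    have "real (Suc i) * \<delta> \<le> power_budget I"
      unfolding level_le_budget_iff[OF I] using i by simp
    then show "tval ?b s' \<and> wp ?c (\<lambda>t s''. t \<le> 20 \<and> ?Inv (Suc i) s'') s'"
      using inv by (auto simp: algebra_simps le_Suc_eq)
  next
    fix s' assume inv: "?Inv ?J s'"
    have "\<not> real (Suc ?J) * \<delta> \<le> power_budget I"
      unfolding level_le_budget_iff[OF I] by simp
    then show "\<not> tval ?b s'" using inv by (auto simp: algebra_simps)
  qed
  then show ?thesis
    unfolding compute_levels_def wp_Seq wp_RSet wp_ISet
    by (auto elim!: wp_mono)
qed

lemma wp_clear_table: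
  assumes s: "ints s ''J'' 0 = J"
  shows "wp clear_table (\<lambda>t s'. t \<le> 50 * (J + 1) \<and> (\<forall>l\<le>J. reals s' ''V'' l = 0)) s"
proof -
  let ?c = "RSet ''V'' (ivar ''l'') (RConst 0)"
  have "wp clear_table (\<lambda>t s'.
      t \<le> (Suc J - 0) * (10 + icost (ivar ''J'') + 9) + icost (ivar ''J'') + 6 \<and>
      (\<forall>l<Suc J. reals s' ''V'' l = 0) \<and> agree (insert ''l'' (iwrites ?c)) (rwrites ?c) s s') s"
    unfolding clear_table_def
    by (rule wp_For) (use s in \<open>auto simp: agree_def less_Suc_eq\<close>)
  then show ?thesis by (rule wp_mono) auto
qed

text \<open>The candidates for subcarrier \<open>n\<close> with less than \<open>i\<close> units when \<open>l\<close> units are left; \<open>V\<close> is the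
  previous row.\<close>

definition row_choices ::
    "(nat \<Rightarrow> real) \<Rightarrow> (nat \<Rightarrow> real) \<Rightarrow> (nat \<Rightarrow> bool) \<Rightarrow> nat \<Rightarrow> nat \<Rightarrow> (real \<times> nat) set" where
  "row_choices V g allowed l i = {(V (l - q) + g q, q) | q. q < i \<and> allowed q}"

lemma row_choices_Suc:
  "row_choices V g allowed l (Suc i) = (if allowed i
     then insert (V (l - i) + g i, i) (row_choices V g allowed l i) else row_choices V g allowed l i)"
  by (auto simp: row_choices_def less_Suc_eq)

lemma row_choices_0: "row_choices V g allowed l 0 = {}"
  by (simp add: row_choices_def)

text \<open>The knapsack tables agree in all cells before cell \<open>k\<close>.\<close>

definition same_below :: "nat \<Rightarrow> store \<Rightarrow> store \<Rightarrow> bool" where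
  "same_below k s s' \<longleftrightarrow>
    (\<forall>j<k. reals s' ''V'' j = reals s ''V'' j \<and> ints s' ''S'' j = ints s ''S'' j)"

lemma wp_extend_table:
  assumes s: "ints s ''J'' 0 = J" "ints s ''n'' 0 = n" and n: "1 \<le> n"
    and zero: "reals s ''L'' 0 \<le> reals s ''Plim'' n"
  defines "V \<equiv> \<lambda>l. reals s ''V'' (cell_pos J (n - 1) l)"
    and "allowed \<equiv> \<lambda>q. reals s ''L'' q \<le> reals s ''Plim'' n"
  shows "wp extend_table (\<lambda>t s'. t \<le> 200 * (J + 1) * (J + 1) \<and> same_below (cell_pos J n 0) s s' \<and>
      (\<forall>l\<le>J. best_of (row_choices V (reals s ''G'') allowed l (Suc l))
        (reals s' ''V'' (cell_pos J n l), ints s' ''S'' (cell_pos J n l)))) s"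
proof -
  let ?body = "If (RLeq (RGet ''L'' (ivar ''q'')) (RGet ''Plim'' (ivar ''n''))) (
         rset ''v'' (RAdd (RGet ''V'' (cell (previous ''n'') (ISub (ivar ''l'') (ivar ''q''))))
           (RGet ''G'' (ivar ''q''))) ;;
         If (RLess (RGet ''V'' (cell (ivar ''n'') (ivar ''l''))) (rvar ''v''))
           (RSet ''V'' (cell (ivar ''n'') (ivar ''l'')) (rvar ''v'') ;;
            ISet ''S'' (cell (ivar ''n'') (ivar ''l'')) (ivar ''q'')) Skip) Skip"
  let ?c = "RSet ''V'' (cell (ivar ''n'') (ivar ''l''))
       (RAdd (RGet ''V'' (cell (previous ''n'') (ivar ''l''))) (RGet ''G'' (IConst 0))) ;;
     ISet ''S'' (cell (ivar ''n'') (ivar ''l'')) (IConst 0) ;;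
     For ''q'' 1 (ivar ''l'') ?body"
  let ?cand = "row_choices V (reals s ''G'') allowed"
  define Inv where "Inv = (\<lambda>i (s' :: store). same_below (cell_pos J n 0) s s' \<and>
    (\<forall>l<i. best_of (?cand l (Suc l))
        (reals s' ''V'' (cell_pos J n l), ints s' ''S'' (cell_pos J n l))))"
  define good where "good s' \<longleftrightarrow> ints s' ''J'' 0 = J \<and> ints s' ''n'' 0 = n \<and>
    reals s' ''L'' = reals s ''L'' \<and> reals s' ''Plim'' = reals s ''Plim'' \<and>
    reals s' ''G'' = reals s ''G''" for s' :: store
  have pos: "cell_pos J (n - Suc 0) l < cell_pos J n 0" if "l \<le> J" for l
    by (rule cell_pos_less) (use n that in auto)
  have ge: "cell_pos J n 0 \<le> cell_pos J n l" for l by (simp add: cell_pos_def)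
  have eq: "cell_pos J n l = cell_pos J n l' \<longleftrightarrow> l = l'" for l l' by (simp add: cell_pos_def)
  have neq: "j < cell_pos J n 0 \<Longrightarrow> j \<noteq> cell_pos J n l" for j l using ge[of l] by auto
  have prev: "reals s' ''V'' (cell_pos J (n - Suc 0) l) = V l"
    if "same_below (cell_pos J n 0) s s'" "l \<le> J" for s' l
    using that pos by (simp add: same_below_def V_def)
  have inner: "wp ?c (\<lambda>t s''. t \<le> 100 * J + 100 \<and> Inv (Suc l) s'') s'"
    if good: "good s'" and l: "ints s' ''l'' 0 = l" "l \<le> J" and inv: "Inv l s'" for l s'
  proof -
    define Inv' where "Inv' = (\<lambda>i (s' :: store). Inv l s' \<and> best_of (?cand l i)
        (reals s' ''V'' (cell_pos J n l), ints s' ''S'' (cell_pos J n l)))"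
    define s1 where "s1 = iupd ''S'' (cell_pos J n l) 0
      (rupd ''V'' (cell_pos J n l) (V l + reals s ''G'' 0) s')"
    have "wp (For ''q'' 1 (ivar ''l'') ?body) (\<lambda>t s'.
        t \<le> (Suc l - 1) * (80 + icost (ivar ''l'') + 9) + icost (ivar ''l'') + 6 \<and>
        Inv' (Suc l) s' \<and> agree (insert ''q'' (iwrites ?body)) (rwrites ?body) s1 s') s1"
    proof (rule wp_For)
      fix s2 assume "agree (insert ''q'' (iwrites ?body)) (rwrites ?body) s1 s2"
      then show "ival (ivar ''l'') s2 = l" using l by (simp add: agree_def s1_def)
    next
      fix s2 assume "agree {''q''} {} s1 s2"
      moreover have "allowed 0" using zero by (simp add: allowed_def)
      ultimately show "Inv' 1 s2"
        using inv eq ge[of l]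
        by (auto simp: agree_def s1_def Inv'_def Inv_def same_below_def row_choices_Suc
            row_choices_0 best_of_def)
    next
      fix i s2
      assume i: "1 \<le> i" "i \<le> l" and q: "ints s2 ''q'' 0 = i" and inv': "Inv' i s2"
        and ag: "agree (insert ''q'' (iwrites ?body)) (rwrites ?body) s1 s2"
      have facts: "ints s2 ''J'' 0 = J" "ints s2 ''n'' 0 = n" "ints s2 ''l'' 0 = l"
        "reals s2 ''L'' = reals s ''L''" "reals s2 ''Plim'' = reals s ''Plim''"
        "reals s2 ''G'' = reals s ''G''"
        using ag good l by (simp_all add: agree_def s1_def good_def)
      have pv: "reals s2 ''V'' (cell_pos J (n - Suc 0) (l - i)) = V (l - i)"
        by (rule prev) (use inv' l in \<open>auto simp: Inv'_def Inv_def\<close>)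
      show "wp ?body (\<lambda>t s''. t \<le> 80 \<and> Inv' (Suc i) s'') s2"
        using inv' q best_of_insert[of "?cand l i" "reals s2 ''V'' (cell_pos J n l)"
            "ints s2 ''S'' (cell_pos J n l)" "V (l - i) + reals s ''G'' i" i]
        unfolding previous_def
        by (auto simp: eq neq facts pv Inv'_def Inv_def row_choices_Suc allowed_def same_below_def not_less)
    next
      fix i v s2 assume "Inv' i s2" then show "Inv' i (iupd ''q'' 0 v s2)"
        by (simp add: Inv'_def Inv_def same_below_def)
    qed auto
    moreover have "reals s' ''V'' (cell_pos J (n - Suc 0) l) = V l"
      by (rule prev) (use inv l in \<open>auto simp: Inv_def\<close>)
    moreover have "ints s' ''J'' 0 = J" "ints s' ''n'' 0 = n" "reals s' ''G'' = reals s ''G''"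
      using good by (auto simp: good_def)
    ultimately show ?thesis
      unfolding wp_Seq wp_RSet wp_ISet previous_def
      using l by (auto elim!: wp_mono simp: s1_def Inv'_def Inv_def less_Suc_eq)
  qed
  have "wp extend_table (\<lambda>t s'.
      t \<le> (Suc J - 0) * ((100 * J + 100) + icost (ivar ''J'') + 9) + icost (ivar ''J'') + 6 \<and>
      Inv (Suc J) s' \<and> agree (insert ''l'' (iwrites ?c)) (rwrites ?c) s s') s"
    unfolding extend_table_def
  proof (rule wp_For)
    fix i s' assume i: "i \<le> J" "ints s' ''l'' 0 = i" "Inv i s'"
      and ag: "agree (insert ''l'' (iwrites ?c)) (rwrites ?c) s s'"
    have "good s'" using ag s by (simp add: agree_def good_def)
    then show "wp ?c (\<lambda>t s''. t \<le> 100 * J + 100 \<and> Inv (Suc i) s'') s'"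
      using i by (intro inner)
  qed (use s in \<open>auto simp: Inv_def agree_def same_below_def\<close>)
  then show ?thesis
    by (rule wp_mono) (auto simp: Inv_def less_Suc_eq_le algebra_simps)
qed

lemma holds_input_agree:
  assumes "holds_input I \<delta> s" "agree A C s s'" "A \<inter> {''K'', ''N'', ''M''} = {}"
    "C \<inter> {''w'', ''W'', ''eta'', ''Plim'', ''Pmax'', ''delta''} = {}"
  shows "holds_input I \<delta> s'"
proof -
  have "ints s' ''K'' = ints s ''K''" "ints s' ''N'' = ints s ''N''" "ints s' ''M'' = ints s ''M''"
    "reals s' ''w'' = reals s ''w''" "reals s' ''W'' = reals s ''W''"
    "reals s' ''eta'' = reals s ''eta''" "reals s' ''Plim'' = reals s ''Plim''"
    "reals s' ''Pmax'' = reals s ''Pmax''" "reals s' ''delta'' = reals s ''delta''"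
    using assms(2-4) unfolding agree_def by blast+
  then show ?thesis using assms(1) by (simp add: holds_input_def)
qed

definition levels_known :: "jspa \<Rightarrow> real \<Rightarrow> store \<Rightarrow> bool" where
  "levels_known I \<delta> s \<longleftrightarrow> ints s ''J'' 0 = num_levels I \<delta> \<and>
    (\<forall>l\<le>num_levels I \<delta>. reals s ''L'' l = real l * \<delta>)"

lemma levels_known_agree:
  "levels_known I \<delta> s \<Longrightarrow> agree A C s s' \<Longrightarrow> ''J'' \<notin> A \<Longrightarrow> ''L'' \<notin> C \<Longrightarrow> levels_known I \<delta> s'"
  by (simp add: levels_known_def agree_def)

lemma wp_treat_subcarriers:
  assumes I: "valid_jspa I" "decoding_orders I \<pi>" "0 < \<delta>"
    and s: "holds_input I \<delta> s" "levels_known I \<delta> s"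
    and V0: "\<And>l. l \<le> num_levels I \<delta> \<Longrightarrow> reals s ''V'' l = 0"
  defines "J \<equiv> num_levels I \<delta>" and "K \<equiv> num_users I" and "M \<equiv> max_mux I" and "N \<equiv> num_subs I"
  shows "wp treat_subcarriers (\<lambda>t s'.
      t \<le> N * (500 * M * (K * K) + 200 * (J + 1) * K + 200 * (J + 1) * (J + 1) + 100 * K + 12) + 9 \<and>
      knapsack N J (\<lambda>n q. sc_opt I \<pi> n (real q * \<delta>)) (\<lambda>n q. real q * \<delta> \<le> power_limit I n)
        (\<lambda>n l. reals s' ''V'' (cell_pos J n l)) (\<lambda>n l. ints s' ''S'' (cell_pos J n l))) s"
proof -
  let ?c = "load_users ;; build_entries ;; evaluate_levels ;; extend_table"
  \<comment> \<open>Row \<open>n\<close> of the tables satisfies the knapsack recursion.\<close>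
  define table where "table n V ch \<longleftrightarrow> (\<forall>l\<le>J. best_of
     {(V (cell_pos J (n - 1) (l - q)) + sc_opt I \<pi> n (real q * \<delta>), q) | q.
        q \<le> l \<and> real q * \<delta> \<le> power_limit I n} (V (cell_pos J n l), ch (cell_pos J n l)))"
    for n and V :: "nat \<Rightarrow> real" and ch :: "nat \<Rightarrow> nat"
  define Inv where "Inv = (\<lambda>i (s' :: store). (\<forall>l\<le>J. reals s' ''V'' l = 0) \<and>
    (\<forall>n\<in>{1..<i}. table n (reals s' ''V'') (ints s' ''S'')))"
  let ?T = "500 * M * (K * K) + 200 * (J + 1) * K + 200 * (J + 1) * (J + 1) + 100 * K"
  have body: "wp ?c (\<lambda>t s''. t \<le> ?T \<and> Inv (Suc n) s'') s'"
    if range: "1 \<le> n" "n \<le> N" and s': "holds_input I \<delta> s'" "levels_known I \<delta> s'"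
      "ints s' ''n'' 0 = n" and inv: "Inv n s'" for n s'
  proof -
    have nN: "n \<in> {1..num_subs I}" using range by (simp add: N_def)
    interpret subcarrier I n "power_budget I" \<pi>
      using I nN by unfold_locales (auto simp: valid_jspa_def)
    have K: "1 \<le> K" and M: "1 \<le> M" and lim: "0 \<le> power_limit I n"
      using I(1) nN by (auto simp: valid_jspa_def K_def M_def)
    have "wp load_users (\<lambda>t s1. t \<le> 100 * K \<and> loaded s1 \<and>
      (\<forall>k\<in>{1..K}. reals s1 ''D'' k = - util k 0 \<and> reals s1 ''X'' k = 0)) s'"
      unfolding K_def by (rule wp_load_users[where n = n])
        (use s' nN K in \<open>auto simp: holds_input_def K_def\<close>)
    from wp_frame[OF this] show ?thesis
      unfolding wp_Seq
    proof (rule wp_mono, elim conjE)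
      fix t1 s1
      assume t1: "t1 \<le> 100 * K" and l1: "loaded s1"
        and first: "\<forall>k\<in>{1..K}. reals s1 ''D'' k = - util k 0 \<and> reals s1 ''X'' k = 0"
        and ag1: "agree (iwrites load_users) (rwrites load_users) s' s1"
      have M1: "ints s1 ''M'' 0 = M"
        using ag1 s'(1) by (simp add: agree_def holds_input_def M_def)
      have "wp build_entries (\<lambda>t s2. t \<le> 500 * M * (K * K) \<and>
          (\<forall>k\<in>{1..K}. entries (M - 1) k s2)) s1"
        using wp_build_entries[OF l1 M1] K M first by (simp add: K_def)
      from wp_frame[OF this] show "wp build_entries (\<lambda>t'. wp evaluate_levels (\<lambda>t'a.
          wp extend_table (\<lambda>t'b s''. t1 + (t' + (t'a + t'b)) \<le> ?T \<and> Inv (Suc n) s''))) s1"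
      proof (rule wp_mono, elim conjE)
        fix t2 s2
        assume t2: "t2 \<le> 500 * M * (K * K)" and e2: "\<forall>k\<in>{1..K}. entries (M - 1) k s2"
          and ag2: "agree (iwrites build_entries) (rwrites build_entries) s1 s2"
        define D where "D k = reals s2 ''D'' ((M - 1) * K + k)" for k
        define X where "X k = reals s2 ''X'' ((M - 1) * K + k)" for k
        have l2: "loaded s2" using loaded_agree[OF l1 ag2] by simp
        have lev2: "levels_known I \<delta> s2"
          using levels_known_agree[OF levels_known_agree[OF s'(2) ag1] ag2] by simp
        have M2: "ints s2 ''M'' 0 = M" using ag2 M1 by (simp add: agree_def)
        have "wp evaluate_levels (\<lambda>t s3. t \<le> 200 * (J + 1) * K \<and>
          (\<forall>l\<le>J. max_of (value_candidates D X (reals s2 ''L'' l) K) (reals s3 ''G'' l))) s2"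
          using wp_evaluate_levels[OF l2 M2, of J] lev2 K
          by (simp add: K_def levels_known_def J_def D_def[abs_def] X_def[abs_def])
        from wp_frame[OF this] show "wp evaluate_levels (\<lambda>t'a.
          wp extend_table (\<lambda>t'b s''. t1 + (t2 + (t'a + t'b)) \<le> ?T \<and> Inv (Suc n) s'')) s2"
        proof (rule wp_mono, elim conjE)
          fix t3 s3
          assume t3: "t3 \<le> 200 * (J + 1) * K"
            and G: "\<forall>l\<le>J. max_of (value_candidates D X (reals s2 ''L'' l) K) (reals s3 ''G'' l)"
            and ag3: "agree (iwrites evaluate_levels) (rwrites evaluate_levels) s2 s3"
          have opt: "optimal_entry (max_mux I - 1) e (D e) (X e)" if "e \<in> {1..num_users I}" for e
            using e2 that by (simp add: entries_def D_def X_def M_def K_def)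
          have G: "reals s3 ''G'' l = sc_opt I \<pi> n (real l * \<delta>)" if "l \<le> J" for l
          proof -
            have "max_of (value_candidates D X (real l * \<delta>) (num_users I)) (reals s3 ''G'' l)"
              using G that lev2 by (simp add: levels_known_def J_def K_def)
            moreover have "real l * \<delta> \<le> power_budget I"
              using that level_le_budget_iff[OF I(1,3)] by (simp add: J_def)
            ultimately show ?thesis
              using sc_opt_eqI[OF opt, of "real l * \<delta>" "reals s3 ''G'' l"] I(3)
              by (simp add: max_of_def)
          qed
          have keep: "reals s3 ''V'' = reals s' ''V''" "ints s3 ''S'' = ints s' ''S''"
            "ints s3 ''J'' = ints s' ''J''" "ints s3 ''n'' = ints s' ''n''"
            "reals s3 ''L'' = reals s' ''L''" "reals s3 ''Plim'' = reals s' ''Plim''"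
            using ag1 ag2 ag3 by (simp_all add: agree_def)
          have J3: "ints s3 ''J'' 0 = J" and n3: "ints s3 ''n'' 0 = n"
            and L3: "\<And>l. l \<le> J \<Longrightarrow> reals s3 ''L'' l = real l * \<delta>"
            and Plim: "reals s3 ''Plim'' n = power_limit I n"
            using keep s' nN by (auto simp: levels_known_def holds_input_def J_def)
          have "reals s3 ''L'' 0 \<le> reals s3 ''Plim'' n" using L3[of 0] Plim lim by simp
          from wp_extend_table[OF J3 n3 range(1) this]
          show "wp extend_table (\<lambda>t s''. t1 + (t2 + (t3 + t)) \<le> ?T \<and> Inv (Suc n) s'') s3"
          proof (rule wp_mono, elim conjE)
            fix t4 s4
            assume t4: "t4 \<le> 200 * (J + 1) * (J + 1)"
              and same: "same_below (cell_pos J n 0) s3 s4"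
              and best: "\<forall>l\<le>J. best_of (row_choices (\<lambda>l. reals s3 ''V'' (cell_pos J (n - 1) l))
                (reals s3 ''G'') (\<lambda>q. reals s3 ''L'' q \<le> reals s3 ''Plim'' n) l (Suc l))
                (reals s4 ''V'' (cell_pos J n l), ints s4 ''S'' (cell_pos J n l))"
            have old: "reals s4 ''V'' (cell_pos J m l) = reals s' ''V'' (cell_pos J m l)"
              "ints s4 ''S'' (cell_pos J m l) = ints s' ''S'' (cell_pos J m l)"
              if "m < n" "l \<le> J" for m l
              using same cell_pos_less[OF that, of 0] keep by (auto simp: same_below_def)
            have "row_choices (\<lambda>l. reals s3 ''V'' (cell_pos J (n - 1) l))
                (reals s3 ''G'') (\<lambda>q. reals s3 ''L'' q \<le> reals s3 ''Plim'' n) l (Suc l) =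
              {(reals s4 ''V'' (cell_pos J (n - 1) (l - q)) + sc_opt I \<pi> n (real q * \<delta>), q) | q.
                q \<le> l \<and> real q * \<delta> \<le> power_limit I n}" if "l \<le> J" for l
              unfolding row_choices_def
              by (rule Collect_cong)
                (use that G L3 Plim old(1)[of "n - 1"] keep(1) range(1) in \<open>auto simp: less_Suc_eq_le\<close>)
            then have new: "table n (reals s4 ''V'') (ints s4 ''S'')"
              using best by (simp add: table_def)
            have "table m (reals s4 ''V'') (ints s4 ''S'')" if m: "m \<in> {1..<n}" for m
            proof -
              have "{(reals s4 ''V'' (cell_pos J (m - 1) (l - q)) + sc_opt I \<pi> m (real q * \<delta>), q) | q.
                  q \<le> l \<and> real q * \<delta> \<le> power_limit I m} =
                {(reals s' ''V'' (cell_pos J (m - 1) (l - q)) + sc_opt I \<pi> m (real q * \<delta>), q) | q.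
                  q \<le> l \<and> real q * \<delta> \<le> power_limit I m}" if "l \<le> J" for l
                by (rule Collect_cong) (use that m old(1)[of "m - 1"] in auto)
              moreover have "table m (reals s' ''V'') (ints s' ''S'')"
                using inv m by (simp add: Inv_def)
              ultimately show ?thesis using m old by (simp add: table_def)
            qed
            then have "\<forall>m\<in>{1..<Suc n}. table m (reals s4 ''V'') (ints s4 ''S'')"
              using new by (auto simp: less_Suc_eq)
            moreover have "\<forall>l\<le>J. reals s4 ''V'' l = 0"
              using old(1)[of 0] range(1) inv by (auto simp: cell_pos_def Inv_def)
            ultimately show "t1 + (t2 + (t3 + t4)) \<le> ?T \<and> Inv (Suc n) s4"
              using t1 t2 t3 t4 by (simp add: Inv_def)
          qed
        qed
      qed
    qed
  qed
  have "wp treat_subcarriers (\<lambda>t s'.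
      t \<le> (Suc N - 1) * (?T + icost (ivar ''N'') + 9) + icost (ivar ''N'') + 6 \<and>
      Inv (Suc N) s' \<and> agree (insert ''n'' (iwrites ?c)) (rwrites ?c) s s') s"
    unfolding treat_subcarriers_def
  proof (rule wp_For)
    fix s' assume "agree (insert ''n'' (iwrites ?c)) (rwrites ?c) s s'"
    then show "ival (ivar ''N'') s' = N" using s(1) by (simp add: agree_def holds_input_def N_def)
  next
    fix s' assume "agree {''n''} {} s s'"
    then show "Inv 1 s'" using V0 by (simp add: agree_def Inv_def J_def)
  next
    fix i s' assume i: "1 \<le> i" "i \<le> N" "ints s' ''n'' 0 = i" "Inv i s'"
      and ag: "agree (insert ''n'' (iwrites ?c)) (rwrites ?c) s s'"
    have "holds_input I \<delta> s'" by (rule holds_input_agree[OF s(1) ag]) simp_all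
    moreover have "levels_known I \<delta> s'" by (rule levels_known_agree[OF s(2) ag]) simp_all
    ultimately show "wp ?c (\<lambda>t s''. t \<le> ?T \<and> Inv (Suc i) s'') s'"
      using i by (intro body)
  next
    fix i v s' assume "Inv i s'" then show "Inv i (iupd ''n'' 0 v s')"
      by (simp add: Inv_def)
  qed auto
  then show ?thesis
  proof (rule wp_mono, elim conjE)
    fix t s'
    assume t: "t \<le> (Suc N - 1) * (?T + icost (ivar ''N'') + 9) + icost (ivar ''N'') + 6"
      and inv: "Inv (Suc N) s'"
    have "knapsack N J (\<lambda>n q. sc_opt I \<pi> n (real q * \<delta>)) (\<lambda>n q. real q * \<delta> \<le> power_limit I n)
        (\<lambda>n l. reals s' ''V'' (cell_pos J n l)) (\<lambda>n l. ints s' ''S'' (cell_pos J n l))"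
    proof
      show "reals s' ''V'' (cell_pos J 0 l) = 0" if "l \<le> J" for l
        using inv that by (simp add: Inv_def cell_pos_def)
    next
      fix n l assume "n < N" "l \<le> J"
      then have "table (Suc n) (reals s' ''V'') (ints s' ''S'')" using inv by (simp add: Inv_def)
      then show "best_of {(reals s' ''V'' (cell_pos J n (l - q)) + sc_opt I \<pi> (Suc n) (real q * \<delta>), q) | q.
          q \<le> l \<and> real q * \<delta> \<le> power_limit I (Suc n)}
        (reals s' ''V'' (cell_pos J (Suc n) l), ints s' ''S'' (cell_pos J (Suc n) l))"
        using \<open>l \<le> J\<close> by (simp add: table_def)
    qed
    then show "t \<le> N * (?T + 12) + 9 \<and>
      knapsack N J (\<lambda>n q. sc_opt I \<pi> n (real q * \<delta>)) (\<lambda>n q. real q * \<delta> \<le> power_limit I n)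
        (\<lambda>n l. reals s' ''V'' (cell_pos J n l)) (\<lambda>n l. ints s' ''S'' (cell_pos J n l))"
      using t by (simp add: algebra_simps)
  qed
qed

lemma wp_backtrack:
  assumes s: "holds_input I \<delta> s" "levels_known I \<delta> s"
  defines "J \<equiv> num_levels I \<delta>" and "N \<equiv> num_subs I"
  defines "ch \<equiv> \<lambda>n l. ints s ''S'' (cell_pos J n l)"
  assumes knap: "knapsack N J g allowed V ch"
  shows "wp backtrack (\<lambda>t s'. t \<le> 70 * N + 20 \<and>
      (\<forall>n\<in>{1..N}. power_vector s' n = real (knapsack.choice N J ch n) * \<delta>)) s"
proof -
  interpret knapsack N J g allowed V ch by (fact knap)
  let ?c = "iset ''n'' (ISub (IAdd (ivar ''N'') (IConst 1)) (ivar ''j'')) ;;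
     iset ''q'' (IGet ''S'' (cell (ivar ''n'') (ivar ''r''))) ;;
     RSet ''P'' (ivar ''n'') (RGet ''L'' (ivar ''q'')) ;;
     iset ''r'' (ISub (ivar ''r'') (ivar ''q''))"
  define Inv where "Inv = (\<lambda>i (s' :: store). ints s' ''r'' 0 = budget_left (i - 1) \<and>
    (\<forall>n\<in>{1..N}. N < n + (i - 1) \<longrightarrow> reals s' ''P'' n = real (choice n) * \<delta>))"
  let ?s = "iupd ''r'' 0 J s"
  have "wp (For ''j'' 1 (ivar ''N'') ?c) (\<lambda>t s'.
      t \<le> (Suc N - 1) * (50 + icost (ivar ''N'') + 9) + icost (ivar ''N'') + 6 \<and>
      Inv (Suc N) s' \<and> agree (insert ''j'' (iwrites ?c)) (rwrites ?c) ?s s') ?s"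
  proof (rule wp_For)
    fix s' assume "agree (insert ''j'' (iwrites ?c)) (rwrites ?c) ?s s'"
    then show "ival (ivar ''N'') s' = N" using s(1) by (simp add: agree_def holds_input_def N_def)
  next
    fix s' assume "agree {''j''} {} ?s s'"
    then show "Inv 1 s'" by (simp add: agree_def Inv_def)
  next
    fix i s' assume i: "1 \<le> i" "i \<le> N" "ints s' ''j'' 0 = i" "Inv i s'"
      and ag: "agree (insert ''j'' (iwrites ?c)) (rwrites ?c) ?s s'"
    obtain j where j: "i = Suc j" using i by (cases i) auto
    have facts: "ints s' ''N'' 0 = N" "ints s' ''S'' = ints s ''S''" "ints s' ''J'' 0 = J"
      "reals s' ''L'' = reals s ''L''"
      using ag s by (simp_all add: agree_def holds_input_def N_def levels_known_def J_def)
    have q: "ints s ''S'' (cell_pos J (N - j) (budget_left j)) = choice (N - j)"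
      unfolding choice_def using i j by (simp add: ch_def)
    have "choice (N - j) \<le> J" using choice_le[of "N - j"] i j by auto
    then have L: "reals s ''L'' (choice (N - j)) = real (choice (N - j)) * \<delta>"
      using s(2) by (simp add: levels_known_def J_def)
    have left: "budget_left (Suc j) = budget_left j - choice (N - j)"
      using i j by (simp add: choice_def)
    have "n = N - j" if "N < n + Suc j" "\<not> N < n + j" for n using that by linarith
    then show "wp ?c (\<lambda>t s''. t \<le> 50 \<and> Inv (Suc i) s'') s'"
      using i j left by (auto simp: Inv_def facts q L simp del: budget_left.simps)
  next
    fix i v s' assume "Inv i s'" then show "Inv i (iupd ''j'' 0 v s')"
      by (simp add: Inv_def)
  qed auto
  moreover have "ints s ''J'' 0 = J" using s(2) by (simp add: levels_known_def J_def)
  ultimately show ?thesis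
    unfolding backtrack_def wp_Seq wp_ISet
    by (auto elim!: wp_mono simp: Inv_def power_vector_def)
qed

section \<open>Correctness and complexity of the program\<close>

lemma cost_bound:
  fixes N M K J :: nat
  assumes "1 \<le> N" "1 \<le> M" "1 \<le> K"
    and t: "t1 \<le> 60 * (J + 1)" "t2 \<le> 50 * (J + 1)"
      "t3 \<le> N * (500 * M * (K * K) + 200 * (J + 1) * K + 200 * (J + 1) * (J + 1) + 100 * K + 12) + 9"
      "t4 \<le> 70 * N + 20"
  shows "t1 + (t2 + (t3 + t4)) \<le> 2000 * (N * M * (K * K) + J * N * M * K + J * J * N)"
proof -
  define a b c where "a = N * M * (K * K)" and "b = J * N * M * K" and "c = J * J * N"
  have "1 \<le> M * K" using assms by simp
  have "N * K * 1 \<le> N * K * (M * K)" by (rule mult_le_mono2) fact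
  then have a: "N * K \<le> a" by (simp add: a_def ac_simps)
  have "N * 1 \<le> N * K" by (rule mult_le_mono2) fact
  then have "N \<le> N * K" by simp
  then have a': "N \<le> a" "1 \<le> a" using a assms(1) by linarith+
  have "(J * N * K) * 1 \<le> (J * N * K) * M" by (rule mult_le_mono2) fact
  then have b: "J * N * K \<le> b" by (simp add: b_def ac_simps)
  have "(J * N) * 1 \<le> (J * N) * K" by (rule mult_le_mono2) fact
  then have "J * N \<le> J * N * K" by simp
  then have b': "J * N \<le> b" using b by linarith
  have "J * 1 \<le> J * N" by (rule mult_le_mono2) fact
  then have "J \<le> J * N" by simp
  then have b'': "J \<le> b" using b' by linarith
  have "t3 \<le> 500 * a + 200 * (J * N * K) + 300 * (N * K) + 200 * c + 400 * (J * N) + 212 * N + 9"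
    using t(3) by (simp add: a_def c_def algebra_simps)
  moreover define x y z where "x = J * N * K" and "y = N * K" and "z = J * N"
  ultimately have "t3 \<le> 500 * a + 200 * x + 300 * y + 200 * c + 400 * z + 212 * N + 9" by simp
  moreover have "t1 \<le> 60 * J + 60" "t2 \<le> 50 * J + 50" using t(1,2) by simp_all
  moreover have "y \<le> a" "x \<le> b" "z \<le> b" using a b b' by (simp_all add: x_def y_def z_def)
  ultimately have "t1 + (t2 + (t3 + t4)) \<le> 1300 * a + 800 * b + 200 * c"
    using t(4) a' b'' by linarith
  also have "\<dots> \<le> 2000 * (a + b + c)" by simp
  finally have "t1 + (t2 + (t3 + t4)) \<le> 2000 * (a + b + c)" .
  then show ?thesis by (simp add: a_def b_def c_def)
qed

lemma wp_opt_jspa: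
  assumes I: "valid_jspa I" "decoding_orders I \<pi>" "0 < \<delta>" and s: "holds_input I \<delta> s"
  defines "J \<equiv> num_levels I \<delta>" and "K \<equiv> num_users I" and "M \<equiv> max_mux I" and "N \<equiv> num_subs I"
  shows "wp opt_jspa (\<lambda>t s'. t \<le> 2000 * (N * M * (K * K) + J * N * M * K + J * J * N) \<and>
    is_arg_max (mc_objective I \<pi>) (\<lambda>P. P \<in> mc_feasible_discrete I \<delta>) (power_vector s')) s"
    (is "wp _ ?Q s")
  unfolding opt_jspa_def wp_Seq
proof (rule wp_mono[OF wp_frame[OF wp_compute_levels[OF I(1,3) s]]], elim conjE)
  fix t1 s1
  assume t1: "t1 \<le> 60 * (num_levels I \<delta> + 1)"
    and lev: "ints s1 ''J'' 0 = num_levels I \<delta>" "\<forall>l\<le>num_levels I \<delta>. reals s1 ''L'' l = real l * \<delta>"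
    and ag: "agree (iwrites compute_levels) (rwrites compute_levels) s s1"
  have in1: "holds_input I \<delta> s1" by (rule holds_input_agree[OF s ag]) simp_all
  have lev1: "levels_known I \<delta> s1" using lev by (simp add: levels_known_def)
  show "wp clear_table (\<lambda>t'. wp treat_subcarriers (\<lambda>t'a. wp backtrack (\<lambda>t'b.
      ?Q (t1 + (t' + (t'a + t'b)))))) s1"
  proof (rule wp_mono[OF wp_frame[OF wp_clear_table[OF lev(1)]]], elim conjE)
    fix t2 s2
    assume t2: "t2 \<le> 50 * (num_levels I \<delta> + 1)" and V0: "\<forall>l\<le>num_levels I \<delta>. reals s2 ''V'' l = 0"
      and ag: "agree (iwrites clear_table) (rwrites clear_table) s1 s2"
    have in2: "holds_input I \<delta> s2" by (rule holds_input_agree[OF in1 ag]) simp_all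
    have lev2: "levels_known I \<delta> s2" by (rule levels_known_agree[OF lev1 ag]) simp_all
    show "wp treat_subcarriers (\<lambda>t'a. wp backtrack (\<lambda>t'b. ?Q (t1 + (t2 + (t'a + t'b))))) s2"
    proof (rule wp_mono[OF wp_frame[OF wp_treat_subcarriers[OF I in2 lev2]]], use V0 in blast, elim conjE)
      fix t3 and s3 :: store
      let ?V = "\<lambda>n l. reals s3 ''V'' (cell_pos (num_levels I \<delta>) n l)"
      let ?ch = "\<lambda>n l. ints s3 ''S'' (cell_pos (num_levels I \<delta>) n l)"
      assume t3: "t3 \<le> num_subs I * (500 * max_mux I * (num_users I * num_users I) +
          200 * (num_levels I \<delta> + 1) * num_users I +
          200 * (num_levels I \<delta> + 1) * (num_levels I \<delta> + 1) + 100 * num_users I + 12) + 9"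
        and knap: "knapsack (num_subs I) (num_levels I \<delta>) (\<lambda>n q. sc_opt I \<pi> n (real q * \<delta>))
          (\<lambda>n q. real q * \<delta> \<le> power_limit I n) ?V ?ch"
        and ag: "agree (iwrites treat_subcarriers) (rwrites treat_subcarriers) s2 s3"
      have in3: "holds_input I \<delta> s3" by (rule holds_input_agree[OF in2 ag]) simp_all
      have lev3: "levels_known I \<delta> s3" by (rule levels_known_agree[OF lev2 ag]) simp_all
      show "wp backtrack (\<lambda>t'b. ?Q (t1 + (t2 + (t3 + t'b)))) s3"
      proof (rule wp_mono[OF wp_backtrack[OF in3 lev3 knap]], elim conjE, intro conjI)
        fix t4 s4
        assume "t4 \<le> 70 * num_subs I + 20"
        with t1 t2 t3 show "t1 + (t2 + (t3 + t4)) \<le>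
            2000 * (N * M * (K * K) + J * N * M * K + J * J * N)"
          unfolding J_def K_def M_def N_def
          by (intro cost_bound) (use I(1) in \<open>auto simp: valid_jspa_def\<close>)
        assume "\<forall>n\<in>{1..num_subs I}. power_vector s4 n =
          real (knapsack.choice (num_subs I) (num_levels I \<delta>) ?ch n) * \<delta>"
        then show "is_arg_max (mc_objective I \<pi>) (\<lambda>P. P \<in> mc_feasible_discrete I \<delta>) (power_vector s4)"
          by (intro is_arg_max_mc_objective[OF I(1,3) knap]) blast
      qed
    qed
  qed
qed

theorem theorem10:
  shows "\<exists>(opt_jspa :: com) (C :: real). \<forall>(I :: jspa) (\<pi> :: nat \<Rightarrow> nat \<Rightarrow> nat) (\<delta> :: real) (s :: store).
     valid_jspa I \<longrightarrow> decoding_orders I \<pi> \<longrightarrow> 0 < \<delta> \<longrightarrow> holds_input I \<delta> s \<longrightarrow>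
     (\<exists>t s'. exec opt_jspa s t s' \<and>
        is_arg_max (mc_objective I \<pi>) (\<lambda>P. P \<in> mc_feasible_discrete I \<delta>) (power_vector s') \<and>
        (let N = real (num_subs I); M = real (max_mux I); K = real (num_users I);
             J = real (num_levels I \<delta>)
         in real t \<le> C * (N * M * K\<^sup>2 + J * N * M * K + J\<^sup>2 * N)))"
proof (rule exI[of _ opt_jspa], rule exI[of _ 2000], intro allI impI)
  fix I \<pi> \<delta> s
  assume I: "valid_jspa I" "decoding_orders I \<pi>" "0 < \<delta>" "holds_input I \<delta> s"
  let ?N = "num_subs I" and ?M = "max_mux I" and ?K = "num_users I" and ?J = "num_levels I \<delta>"
  obtain t s' where exec: "exec opt_jspa s t s'"
    and t: "t \<le> 2000 * (?N * ?M * (?K * ?K) + ?J * ?N * ?M * ?K + ?J * ?J * ?N)"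
    and opt: "is_arg_max (mc_objective I \<pi>) (\<lambda>P. P \<in> mc_feasible_discrete I \<delta>) (power_vector s')"
    using wp_opt_jspa[OF I] unfolding wp_def by blast
  from t have "real t \<le> real (2000 * (?N * ?M * (?K * ?K) + ?J * ?N * ?M * ?K + ?J * ?J * ?N))"
    by (rule of_nat_mono)
  also have "\<dots> = 2000 * (real ?N * real ?M * (real ?K)\<^sup>2 + real ?J * real ?N * real ?M * real ?K +
      (real ?J)\<^sup>2 * real ?N)"
    by (simp add: power2_eq_square)
  finally show "\<exists>t s'. exec opt_jspa s t s' \<and>
      is_arg_max (mc_objective I \<pi>) (\<lambda>P. P \<in> mc_feasible_discrete I \<delta>) (power_vector s') \<and>
      (let N = real ?N; M = real ?M; K = real ?K; J = real ?J
       in real t \<le> 2000 * (N * M * K\<^sup>2 + J * N * M * K + J\<^sup>2 * N))"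
    unfolding Let_def using exec opt by blast
qed

end
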